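(* Let $P,Q$ be Dyck paths of semilength $n$. There exists a permutation $\alpha\in S_n$ with $\lambda(\alpha)=P$ and $\mu(\alpha)=Q$ if and only if $L'(Q)\le P$ and $L'(P)\le Q$.
   Context: Dyck path of semilength $n$: lattice path from $(0,0)$ to $(2n,0)$ with steps $U=(1,1)$, $D=(1,-1)$, never below the $x$-axis. A return is a down step ending on the $x$-axis; a Dyck path is irreducible if it has exactly one return; every Dyck path factors uniquely as $P=P_1\cdots P_r$ with each $P_i$ irreducible (its irreducible components). If $P$ has ascents (maximal runs of $U$) of lengths $a_1,\dots,a_k$ and descents of lengths $d_1,\dots,d_k$ (left to right), with $A_i=a_1+\dots+a_i$, $D_i=d_1+\dots+d_i$, its ascent-descent code is $(A,D)$, $A=A_1,\dots,A_{k-1}$, $D=D_1,\dots,D_{k-1}$; this determines $P$. $P$ is irreducible iff $A_i>D_i$ for all $i$. Order $\le$: for irreducible $P,Q$ of the same semilength with $P$ having code $A=A_1,\dots,A_k$, $D=D_1,\dots,D_k$, $Q$ covers $P$ if the ascent code of $Q$ is obtained from $A$ by deleting some $A_i$ and the descent code of $Q$ is obtained from $D$ by deleting some $D_j$ with $j\ge i$. On irreducible paths, $\le$ is the reflexive-transitive closure of this covering relation. For arbitrary Dyck paths with irreducible decompositions $P=P_1\cdots P_r$, $Q=Q_1\cdots Q_s$, $P\le Q$ iff $r=s$ and $P_i\le Q_i$ for all $i$. The map $L'$: for an irreducible path $P$ of semilength $n$ with code $A=A_1,\dots,A_h$, $D=D_1,\dots,D_h$, let $\{\hat A_1>\dots>\hat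 A_{n-2-h}\}=\{1,\dots,n-2\}\setminus\{A_1-1,\dots,A_h-1\}$ and $\{\hat D_1>\dots>\hat D_{n-2-h}\}=\{1,\dots,n-2\}\setminus\{D_1,\dots,D_h\}$; $L'(P)$ is the irreducible Dyck path of semilength $n$ with code $A'_i=n-\hat A_i$, $D'_i=n-1-\hat D_i$. For a general path, $L'(P_1\cdots P_r)=L'(P_r)\cdots L'(P_1)$. For $\sigma=x_1\cdots x_n$: $x_i$ is a left-to-right (LTR) minimum if $x_i<x_j$ for all $j<i$; $x_i$ is a right-to-left (RTL) maximum if $x_i>x_j$ for all $j>i$. $\lambda(\sigma)$: write $\sigma=m_1w_1\cdots m_kw_k$ with $m_1>\dots>m_k$ the LTR minima and $w_i$ possibly empty words, $m_0=n+1$; $\lambda(\sigma)=U^{m_0-m_1}D^{|w_1|+1}\cdots U^{m_{k-1}-m_k}D^{|w_k|+1}$. $\mu(\sigma)$: write $\sigma=u_hM_h\cdots u_1M_1$ with $M_1<\dots<M_h$ the RTL maxima and $u_i$ possibly empty words, $M_0=0$; $\mu(\sigma)=U^{M_1-M_0}D^{|u_1|+1}U^{M_2-M_1}D^{|u_2|+1}\cdots U^{M_h-M_{h-1}}D^{|u_h|+1}$. *)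

theory Defs
  imports Main
begin

text \<open>A lattice path is a list of steps: True = U = (1,1), False = D = (1,-1).\<close>

definition height :: "bool list \<Rightarrow> int" where
  "height xs = int (count_list xs True) - int (count_list xs False)"

definition dyck :: "bool list \<Rightarrow> bool" where
  "dyck P \<longleftrightarrow> height P = 0 \<and> (\<forall>i \<le> length P. height (take i P) \<ge> 0)"

definition semilength :: "bool list \<Rightarrow> nat" where
  "semilength P = length P div 2"

definition returns :: "bool list \<Rightarrow> nat" where
  "returns P = card {i. 0 < i \<and> i \<le> length P \<and> \<not> P ! (i - 1) \<and> height (take i P) = 0}"

definition irreducible_dyck :: "bool list \<Rightarrow> bool" where
  "irreducible_dyck P \<longleftrightarrow> dyck P \<and> returns P = 1"

text \<open>Irreducible components (the decomposition is unique).\<close>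
definition components :: "bool list \<Rightarrow> bool list list" where
  "components P = (THE Ps. concat Ps = P \<and> (\<forall>p\<in>set Ps. irreducible_dyck p))"

fun runs :: "'a list \<Rightarrow> ('a \<times> nat) list" where
  "runs [] = []"
| "runs (x # xs) = (case runs xs of
      [] \<Rightarrow> [(x, 1)]
    | (y, k) # r \<Rightarrow> (if x = y then (y, Suc k) # r else (x, 1) # (y, k) # r))"

definition ascents :: "bool list \<Rightarrow> nat list" where
  "ascents P = map snd (filter fst (runs P))"

definition descents :: "bool list \<Rightarrow> nat list" where
  "descents P = map snd (filter (\<lambda>r. \<not> fst r) (runs P))"

definition psums :: "nat list \<Rightarrow> nat list" where
  "psums xs = map (\<lambda>i. sum_list (take i xs)) [1..<length xs]"

definition asc_code :: "bool list \<Rightarrow> nat list" where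
  "asc_code P = psums (ascents P)"

definition desc_code :: "bool list \<Rightarrow> nat list" where
  "desc_code P = psums (descents P)"

definition del_at :: "nat \<Rightarrow> 'a list \<Rightarrow> 'a list" where
  "del_at i xs = take i xs @ drop (Suc i) xs"

text \<open>covers P Q: Q covers P (indices 0-based: i \<le> j).\<close>
definition covers :: "bool list \<Rightarrow> bool list \<Rightarrow> bool" where
  "covers P Q \<longleftrightarrow> irreducible_dyck P \<and> irreducible_dyck Q \<and> semilength P = semilength Q \<and>
     (\<exists>i j. i \<le> j \<and> j < length (desc_code P) \<and>
        asc_code Q = del_at i (asc_code P) \<and> desc_code Q = del_at j (desc_code P))"

definition irr_le :: "bool list \<Rightarrow> bool list \<Rightarrow> bool" where
  "irr_le P Q \<longleftrightarrow> irreducible_dyck P \<and> irreducible_dyck Q \<and> semilength P = semilength Q \<and>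
     covers\<^sup>*\<^sup>* P Q"

definition dyck_le :: "bool list \<Rightarrow> bool list \<Rightarrow> bool" where
  "dyck_le P Q \<longleftrightarrow> list_all2 irr_le (components P) (components Q)"

definition L'_irr :: "bool list \<Rightarrow> bool list" where
  "L'_irr P = (let n = semilength P;
      Ahat = rev (sorted_list_of_set ({1..n-2} - (\<lambda>a. a - 1) ` set (asc_code P)));
      Dhat = rev (sorted_list_of_set ({1..n-2} - set (desc_code P)));
      A' = map (\<lambda>a. n - a) Ahat;
      D' = map (\<lambda>d. n - 1 - d) Dhat
    in THE Q. irreducible_dyck Q \<and> semilength Q = n \<and> asc_code Q = A' \<and> desc_code Q = D')"

definition L' :: "bool list \<Rightarrow> bool list" where
  "L' P = concat (rev (map L'_irr (components P)))"

text \<open>Each LTR minimum x (previous minimum m) contributes U^(m-x) D, every other letter D.\<close>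
fun lam_aux :: "nat \<Rightarrow> nat list \<Rightarrow> bool list" where
  "lam_aux m [] = []"
| "lam_aux m (x # xs) = (if x < m then replicate (m - x) True @ False # lam_aux x xs
                         else False # lam_aux m xs)"

definition lam :: "nat list \<Rightarrow> bool list" where
  "lam \<sigma> = lam_aux (length \<sigma> + 1) \<sigma>"

text \<open>Reading from the right: each RTL maximum x (previous maximum m) contributes U^(x-m) D,
  every other letter D.\<close>
fun mu_aux :: "nat \<Rightarrow> nat list \<Rightarrow> bool list" where
  "mu_aux m [] = []"
| "mu_aux m (x # xs) = (if m < x then replicate (x - m) True @ False # mu_aux x xs
                        else False # mu_aux m xs)"

definition mu :: "nat list \<Rightarrow> bool list" where
  "mu \<sigma> = mu_aux 0 (rev \<sigma>)"

definition is_perm :: "nat \<Rightarrow> nat list \<Rightarrow> bool" where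
  "is_perm n \<sigma> \<longleftrightarrow> distinct \<sigma> \<and> set \<sigma> = {1..n}"

lemma "lam [3,1,2] = [True, False, True, True, False, False]" by (simp add: lam_def numeral_eq_Suc)
lemma "mu [3,1,2] = [True,True,False,False,True,False]" by (simp add: mu_def numeral_eq_Suc)
lemma "asc_code [True,True,False,True,False,False] = [2]" by (simp add: asc_code_def ascents_def psums_def)
lemma "desc_code [True,True,False,True,False,False] = [1]" by (simp add: desc_code_def descents_def psums_def)

end

theory Submission
  imports Defs "HOL-Library.Infinite_Set"
begin

text \<open>
  A Dyck path is encoded by the list of numbers of up steps preceding its successive down steps.
  For \<open>\<mu>(\<alpha>)\<close> this list consists of the running maxima of \<open>\<alpha>\<close> read from the right, and for
  \<open>\<lambda>(\<alpha>)\<close> of the running maxima of the complement \<open>n + 1 - \<alpha>\<close>. Returns of either path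
  correspond to skew decompositions of \<open>\<alpha>\<close>, so it suffices to treat irreducible \<open>P\<close> and \<open>Q\<close>.

  On irreducible paths, \<open>P \<le> Q\<close> holds iff the code of \<open>Q\<close> is a subsequence of the code of \<open>P\<close>
  in such a way that the \<open>l\<close>-th entry of the ascent code of \<open>Q\<close> has at least the index in \<open>P\<close> that
  the \<open>l\<close>-th entry of its descent code has. The code of \<open>L'(Q)\<close> lists the values and the positions
  that are not occupied by right-to-left maxima. Hence \<open>L'(Q) \<le> P\<close> says that the left-to-right
  minima prescribed by \<open>P\<close> avoid the right-to-left maxima prescribed by \<open>Q\<close>, and that before each
  left-to-right minimum there are at most as many positions to fill as there are sufficiently large
  values. The latter is clearly necessary. Conversely, if both conditions hold, filling the
  remaining values decreasingly into the remaining positions creates no new extrema.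
\<close>

section \<open>Dyck paths as lists of up-step counts\<close>

text \<open>At position \<open>i\<close> of the complement \<open>xs\<close>, the prescribed extrema
  leave the values from \<open>n + 1 - w ! (n - 1 - i)\<close> to \<open>u ! i\<close>, where
  \<open>u\<close> and \<open>w\<close> are the count lists of \<open>P\<close> and
  \<open>Q\<close>. Both ends grow weakly with \<open>i\<close>, so a pigeonhole count decides
  whether a filling exists, and an increasing filling of \<open>xs\<close> works whenever any does.
  The count for the upper ends comes from \<open>L'(Q) \<le> P\<close>, the one for the lower ends
  from \<open>L'(P) \<le> Q\<close>; reverse-complement exchanges them, which is why the theorem has
  two comparisons. Irreducibility keeps the lower end strictly below the upper one
  (\<open>irreducible_ups_sum\<close>), so the two sides can be handled independently. The ends are
  step functions of \<open>i\<close>, so one inequality per code entry suffices. The codes also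
  count the prescribed minima, but their positions and values are in bijection and cancel. The order
  of components is reversed in \<open>L'\<close> because \<mu> reads the permutation from the
  right.\<close>

fun ups :: "nat \<Rightarrow> bool list \<Rightarrow> nat list" where
  "ups c [] = []"
| "ups c (b # xs) = (if b then ups (Suc c) xs else c # ups c xs)"

fun rmax :: "nat \<Rightarrow> nat list \<Rightarrow> nat list" where
  "rmax c [] = []"
| "rmax c (x # xs) = max c x # rmax (max c x) xs"

lemma ups_append: "ups c (xs @ ys) = ups c xs @ ups (c + count_list xs True) ys"
  by (induction xs arbitrary: c) auto

lemma ups_replicate_True: "ups c (replicate k True @ xs) = ups (c + k) xs"
  by (induction k arbitrary: c) auto

lemma ups_replicate_False: "ups c (replicate k False @ xs) = replicate k c @ ups c xs"
  by (induction k) auto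

lemma length_ups: "length (ups c xs) = count_list xs False"
  by (induction xs arbitrary: c) auto

lemma sorted_ups: "sorted (ups c xs) \<and> (\<forall>x\<in>set (ups c xs). c \<le> x \<and> x \<le> c + count_list xs True)"
proof (induction xs arbitrary: c)
  case (Cons b xs)
  show ?case using Cons[of c] Cons[of "Suc c"] by (cases b) auto
qed simp

lemma count_list_True_False: "count_list xs True + count_list xs False = length xs"
  by (induction xs) auto

lemma length_rmax: "length (rmax c xs) = length xs"
  by (induction xs arbitrary: c) auto

lemma ups_mu_aux: "ups c (mu_aux c xs) = rmax c xs"
  by (induction xs arbitrary: c) (auto simp: ups_replicate_True max_def)

text \<open>Here \<open>k\<close> counts up steps already read but not yet closed by a down step. Up
  steps after the last down step leave no trace in \<open>ups\<close>, hence the condition on the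
  last step.\<close>

lemma mu_aux_ups_add:
  assumes "P \<noteq> []" "\<not> last P"
  shows "mu_aux c (ups (c + k) P) = replicate k True @ P"
  using assms
proof (induction P arbitrary: c k)
  case (Cons b P)
  show ?case
  proof (cases b)
    case True
    then have "P \<noteq> []" "\<not> last P" using Cons.prems by (auto split: if_splits)
    then have "mu_aux c (ups (c + Suc k) P) = replicate (Suc k) True @ P"
      using Cons.IH by blast
    then show ?thesis using True by (simp add: replicate_app_Cons_same)
  next
    case False
    have "mu_aux (c + k) (ups (c + k) P) = P"
    proof (cases "P = []")
      case False
      then show ?thesis using Cons.IH[of "c + k" 0] Cons.prems by simp
    qed simp
    then show ?thesis using False by (cases "k = 0") auto
  qed
qed simp

lemma mu_aux_ups: "P = [] \<or> \<not> last P \<Longrightarrow> mu_aux c (ups c P) = P"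
  using mu_aux_ups_add[of P c 0] by (cases "P = []") auto

lemma mu_aux_rmax: "mu_aux c (rmax c xs) = mu_aux c xs"
  by (induction xs arbitrary: c) (auto simp: max_def)

lemma rmax_nth: "i < length xs \<Longrightarrow> rmax c xs ! i = Max (insert c (set (take (Suc i) xs)))"
proof (induction xs arbitrary: c i)
  case (Cons x xs)
  show ?case
  proof (cases i)
    case (Suc j)
    then have "rmax c (x # xs) ! i = Max (insert (max c x) (set (take (Suc j) xs)))"
      using Cons by simp
    also have "\<dots> = max (max c x) (Max (insert (max c x) (set (take (Suc j) xs))))"
      by (rule max.absorb2[symmetric], rule Max_ge) simp_all
    finally show ?thesis using Suc Cons.prems
      by (cases xs) (simp_all add: ac_simps)
  qed simp
qed simp

lemma mu_aux_append: "mu_aux c (xs @ ys) = mu_aux c xs @ mu_aux (fold max xs c) ys"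
  by (induction xs arbitrary: c) (auto simp: max_def)

lemma mu_aux_shift: "mu_aux (k + c) (map ((+) k) xs) = mu_aux c xs"
  by (induction xs arbitrary: c) auto

lemma count_mu_aux:
  "count_list (mu_aux c xs) False = length xs"
  "c + count_list (mu_aux c xs) True = fold max xs c"
proof -
  have r: "count_list (replicate k True) False = 0" "count_list (replicate k True) True = k" for k
    by (induction k) auto
  show "count_list (mu_aux c xs) False = length xs"
    by (induction xs arbitrary: c) (auto simp: r)
  show "c + count_list (mu_aux c xs) True = fold max xs c"
  proof (induction xs arbitrary: c)
    case (Cons x xs)
    show ?case
    proof (cases "c < x")
      case True
      then show ?thesis using Cons[of x] by (simp add: r max_def)
    next
      case False
      then show ?thesis using Cons[of c] by (simp add: max_def)
    qed
  qed simp
qed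

section \<open>Heights, the Dyck condition and irreducibility\<close>

lemma height_simps [simp]:
  "height [] = 0"
  "height (x # xs) = (if x then 1 else -1) + height xs"
  "height (xs @ ys) = height xs + height ys"
  by (simp_all add: height_def)

text \<open>The path \<open>P\<close> continues after \<open>c\<close> up steps and \<open>d\<close>
  down steps. Only a down step can lead to a new low, and the one with index \<open>j\<close> is
  number \<open>d + j + 1\<close> overall, preceded by \<open>ups c P ! j\<close> up steps.\<close>

lemma prefix_heights_nonneg_iff:
  "(\<forall>i\<le>length P. 0 \<le> int c - int d + height (take i P)) \<longleftrightarrow>
     d \<le> c \<and> (\<forall>j<length (ups c P). d + j < ups c P ! j)"
proof (induction P arbitrary: c d)
  case (Cons b P)
  have all: "(\<forall>i\<le>length (b # P). Q i) \<longleftrightarrow> Q 0 \<and> (\<forall>i\<le>length P. Q (Suc i))" for Q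
    by (simp add: All_less_Suc2 flip: less_Suc_eq_le)
  show ?case
  proof (cases b)
    case True
    have "(\<forall>i\<le>length (b # P). 0 \<le> int c - int d + height (take i (b # P))) \<longleftrightarrow>
       d \<le> c \<and> (\<forall>i\<le>length P. 0 \<le> int (Suc c) - int d + height (take i P))"
      unfolding all using True by (auto simp: algebra_simps)
    also have "\<dots> \<longleftrightarrow> d \<le> c \<and> (\<forall>j<length (ups (Suc c) P). d + j < ups (Suc c) P ! j)"
      unfolding Cons by auto
    finally show ?thesis using True by simp
  next
    case False
    have "(\<forall>i\<le>length (b # P). 0 \<le> int c - int d + height (take i (b # P))) \<longleftrightarrow>
       d \<le> c \<and> (\<forall>i\<le>length P. 0 \<le> int c - int (Suc d) + height (take i P))"
      unfolding all using False by (auto simp: algebra_simps)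
    also have "\<dots> \<longleftrightarrow> d < c \<and> (\<forall>j<length (ups c P). Suc d + j < ups c P ! j)"
      unfolding Cons by auto
    also have "\<dots> \<longleftrightarrow> d \<le> c \<and> (\<forall>j<length (ups c (b # P)). d + j < ups c (b # P) ! j)"
      using False by (auto simp: less_Suc_eq_0_disj)
    finally show ?thesis .
  qed
qed auto

lemma dyck_iff_ups:
  "dyck P \<longleftrightarrow> height P = 0 \<and> (\<forall>j<length (ups 0 P). j < ups 0 P ! j)"
  using prefix_heights_nonneg_iff[of P 0 0] by (simp add: dyck_def)

lemma dyck_counts:
  assumes "height P = 0"
  shows "count_list P True = semilength P" "count_list P False = semilength P"
        "length P = 2 * semilength P"
  using assms count_list_True_False[of P] unfolding height_def semilength_def by presburger+

lemma dyck_take: "dyck P \<Longrightarrow> i \<le> length P \<Longrightarrow> 0 \<le> height (take i P)"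
  by (simp add: dyck_def)

lemma dyck_last: "dyck P \<Longrightarrow> P = [] \<or> \<not> last P"
proof (rule ccontr)
  assume P: "dyck P" and "\<not> (P = [] \<or> \<not> last P)"
  then obtain R where R: "P = R @ [True]" by (metis append_butlast_last_id)
  then have "height R = -1" using P by (simp add: dyck_def)
  moreover have "0 \<le> height (take (length R) P)"
    using dyck_take[OF P, of "length R"] R by simp
  ultimately show False using R by simp
qed

lemma dyck_append_right: "dyck (P @ Q) \<Longrightarrow> height P = 0 \<Longrightarrow> dyck Q"
proof -
  assume a: "dyck (P @ Q)" "height P = 0"
  have "0 \<le> height (take i Q)" if "i \<le> length Q" for i
  proof -
    have "0 \<le> height (take (length P + i) (P @ Q))"
      using dyck_take[OF a(1), of "length P + i"] that by simp
    then show ?thesis using a(2) by simp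
  qed
  then show ?thesis using a by (simp add: dyck_def)
qed

text \<open>\<open>mu_aux\<close> depends on its list only through the running maxima, and
  \<open>ups\<close> loses nothing on Dyck paths because these do not end with an up step.\<close>

lemma mu_aux_eq_iff: "dyck P \<Longrightarrow> mu_aux 0 xs = P \<longleftrightarrow> rmax 0 xs = ups 0 P"
proof
  assume "dyck P" "rmax 0 xs = ups 0 P"
  then show "mu_aux 0 xs = P" using mu_aux_rmax[of 0 xs] mu_aux_ups[OF dyck_last, of P 0] by simp
qed (use ups_mu_aux in auto)

lemma irreducible_dyck_iff_heights:
  "irreducible_dyck P \<longleftrightarrow>
     P \<noteq> [] \<and> height P = 0 \<and> (\<forall>i. 0 < i \<and> i < length P \<longrightarrow> 0 < height (take i P))"
  (is "_ \<longleftrightarrow> ?R")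
proof
  let ?S = "{i. 0 < i \<and> i \<le> length P \<and> \<not> P ! (i - 1) \<and> height (take i P) = 0}"
  assume "irreducible_dyck P"
  then have d: "dyck P" and c: "card ?S = 1" by (auto simp: irreducible_dyck_def returns_def)
  have ne: "P \<noteq> []"
  proof
    assume "P = []"
    then have "?S = {}" by auto
    then show False using c by (metis card.empty zero_neq_one)
  qed
  \<comment> \<open>A point on the axis is reached by a down step, since an up step would start at
    height -1. So every zero of the height at a positive index is a return.\<close>
  have mem: "i \<in> ?S" if "0 < i" "i \<le> length P" "height (take i P) = 0" for i
  proof -
    obtain k where k: "i = Suc k" using \<open>0 < i\<close> by (cases i) auto
    have "height (take i P) = height (take k P) + (if P ! k then 1 else -1)"
      using that k by (simp add: take_Suc_conv_app_nth)
    moreover have "0 \<le> height (take k P)" using d that k by (simp add: dyck_def)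
    ultimately show ?thesis using that k by (auto split: if_splits)
  qed
  have lP: "length P \<in> ?S" using mem d ne by (simp add: dyck_def)
  obtain x where x: "?S = {x}" using c card_1_singletonE by blast
  have S: "?S = {length P}" using lP unfolding x by simp
  show ?R
  proof (intro conjI allI impI)
    fix i assume i: "0 < i \<and> i < length P"
    have "height (take i P) \<noteq> 0"
    proof
      assume "height (take i P) = 0"
      then have "i \<in> {length P}" using mem[of i] i unfolding S by simp
      then show False using i by simp
    qed
    moreover have "0 \<le> height (take i P)" using d i by (simp add: dyck_def)
    ultimately show "0 < height (take i P)" by simp
  qed (use ne d in \<open>auto simp: dyck_def\<close>)
next
  assume R: ?R
  let ?S = "{i. 0 < i \<and> i \<le> length P \<and> \<not> P ! (i - 1) \<and> height (take i P) = 0}"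
  have "0 \<le> height (take i P)" if "i \<le> length P" for i
    using R that less_imp_le[of 0 "height (take i P)"] by (cases "i = 0 \<or> i = length P") auto
  then have d: "dyck P" using R by (simp add: dyck_def)
  have "i = length P" if "i \<in> ?S" for i
    using that R by (cases "i = length P") force+
  moreover have "length P \<in> ?S" using R dyck_last[OF d] by (simp add: last_conv_nth)
  ultimately have "?S = {length P}" by blast
  then show "irreducible_dyck P" using d by (simp add: irreducible_dyck_def returns_def)
qed

lemma irreducible_dyckD: "irreducible_dyck P \<Longrightarrow> dyck P"
  by (simp add: irreducible_dyck_def)

lemma irreducible_dyck_nonempty: "irreducible_dyck P \<Longrightarrow> P \<noteq> []"
  by (simp add: irreducible_dyck_iff_heights)

lemma irreducible_dyck_iff_lift:
  "irreducible_dyck P \<longleftrightarrow> (\<exists>R. P = True # R @ [False] \<and> dyck R)"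
proof
  assume irr: "irreducible_dyck P"
  then have ne: "P \<noteq> []" and h: "height P = 0" and pos: "\<And>i. 0 < i \<Longrightarrow> i < length P \<Longrightarrow> 0 < height (take i P)"
    by (auto simp: irreducible_dyck_iff_heights)
  have l: "\<not> last P" using dyck_last irr ne by (auto simp: irreducible_dyck_def)
  obtain b S where P: "P = b # S" using ne by (cases P) auto
  have "S \<noteq> []" using h P by (auto split: if_splits)
  then obtain R where S: "S = R @ [False]" using l P
    by (cases S rule: rev_cases) auto
  have b: b using pos[of 1] P S by (auto split: if_splits)
  have "0 \<le> height (take i R)" if "i \<le> length R" for i
    using pos[of "Suc i"] P S b that by simp
  then have "dyck R" using h P S b by (simp add: dyck_def)
  then show "\<exists>R. P = True # R @ [False] \<and> dyck R" using P S b by auto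
next
  assume "\<exists>R. P = True # R @ [False] \<and> dyck R"
  then obtain R where R: "P = True # R @ [False]" "dyck R" by auto
  have "0 < height (take i P)" if i: "0 < i" "i < length P" for i
  proof -
    obtain k where k: "i = Suc k" using i by (cases i) auto
    then have "k \<le> length R" using i R by simp
    then have "0 \<le> height (take k R)" using R by (simp add: dyck_def)
    then show ?thesis using k R \<open>k \<le> length R\<close> by simp
  qed
  then show "irreducible_dyck P" using R by (simp add: irreducible_dyck_iff_heights dyck_def)
qed

text \<open>Without its first and last step an irreducible path is a Dyck path, so the bound of
  \<open>dyck_iff_ups\<close> improves by one, except at the last entry, which is
  \<open>n\<close>.\<close>

lemma irreducible_ups:
  assumes "irreducible_dyck P" and n: "semilength P = n" and u: "u = ups 0 P"
  shows "0 < n" "length u = n" "sorted u" "u ! (n - 1) = n"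
    "\<And>i. i < n \<Longrightarrow> u ! i \<le> n" "\<And>i. Suc i < n \<Longrightarrow> Suc i < u ! i"
proof -
  obtain R where R: "P = True # R @ [False]" "dyck R"
    using assms irreducible_dyck_iff_lift by auto
  have h: "height P = 0" using assms by (simp add: irreducible_dyck_def dyck_def)
  show len: "length u = n" using dyck_counts[OF h] n u by (simp add: length_ups)
  show "0 < n" using n R by (simp add: semilength_def)
  show "sorted u" using sorted_ups u by blast
  show "u ! i \<le> n" if "i < n" for i
    using sorted_ups[of 0 P] that u len dyck_counts[OF h] n by (metis add_0 nth_mem)
  have u': "u = ups 1 R @ [n]" using R dyck_counts(1)[OF h] n u by (simp add: ups_append)
  then show "u ! (n - 1) = n" using len by (auto simp: nth_append)
  \<comment> \<open>\<open>c = 1\<close> counts the removed first step, and \<open>d = 1\<close>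
    lifts the floor to height 1, where \<open>R\<close> starts and ends inside
    \<open>P\<close>.\<close>
  have "\<forall>i\<le>length R. 0 \<le> int 1 - int 1 + height (take i R)" using R by (simp add: dyck_def)
  then have "\<forall>j<length (ups 1 R). 1 + j < ups 1 R ! j"
    unfolding prefix_heights_nonneg_iff by blast
  then show "Suc i < u ! i" if "Suc i < n" for i
    using that u' len by (auto simp: nth_append)
qed

lemma irreducible_dyckI_ups:
  assumes P: "P = [] \<or> \<not> last P" and u: "u = ups 0 P" and len: "length u = n"
    and n: "0 < n" and l: "u ! (n - 1) = n" and gt: "\<And>i. Suc i < n \<Longrightarrow> Suc i < u ! i"
  shows "irreducible_dyck P" "semilength P = n"
proof -
  have "P \<noteq> []" using u len n by auto
  then obtain S where S: "P = S @ [False]" using P by (cases P rule: rev_cases) auto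
  have u': "u = ups 0 S @ [count_list S True]" using u S by (simp add: ups_append)
  have "n = Suc (length (ups 0 S))" using u' len by simp
  then have ct: "count_list S True = n" using u' l by (simp add: nth_append)
  have cf: "count_list S False = n - 1" using u' len by (auto simp: length_ups)
  have "S \<noteq> []" using ct n by auto
  then obtain b R where bR: "S = b # R" by (cases S) auto
  have b: b
  proof (rule ccontr)
    assume "\<not> b"
    then have "u ! 0 = 0" "Suc 0 < n" using u' bR cf by auto
    then show False using gt[of 0] by simp
  qed
  have hR: "height R = 0" using ct cf bR b n by (simp add: height_def)
  have "\<forall>j<length (ups 1 R). 1 + j < ups 1 R ! j"
    using gt u' bR b len by (auto simp: nth_append)
  then have "\<forall>i\<le>length R. 0 \<le> int 1 - int 1 + height (take i R)"
    unfolding prefix_heights_nonneg_iff by simp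
  then have "dyck R" using hR by (simp add: dyck_def)
  then show "irreducible_dyck P" using S bR b irreducible_dyck_iff_lift by auto
  show "semilength P = n" using ct cf S count_list_True_False[of S] n
    by (simp add: semilength_def)
qed

section \<open>Unique factorization into irreducible components\<close>

lemma irreducible_prefix_eq:
  assumes "irreducible_dyck p" "irreducible_dyck q" "p @ xs = q @ ys"
  shows "p = q"
proof -
  \<comment> \<open>If \<open>p\<close> were a proper prefix of \<open>q\<close>, the height at its
    end would be positive because \<open>q\<close> is irreducible, yet \<open>p\<close> ends on the
    axis.\<close>
  have *: "p = q" if "irreducible_dyck p" "irreducible_dyck q" "p @ us = q" for p q us :: "bool list"
  proof (rule ccontr)
    assume "p \<noteq> q"
    then have "0 < length p" "length p < length q" "take (length p) q = p"
      using that by (auto simp: irreducible_dyck_iff_heights)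
    moreover have "height p = 0" using that by (simp add: irreducible_dyck_iff_heights)
    ultimately show False using that(2) unfolding irreducible_dyck_iff_heights by fastforce
  qed
  from assms(3) show ?thesis
    unfolding append_eq_append_conv2 using *[OF assms(1,2)] *[OF assms(2,1)] by auto
qed

lemma irreducible_concat_unique:
  assumes "concat Ps = concat Qs" "\<forall>p\<in>set Ps. irreducible_dyck p" "\<forall>q\<in>set Qs. irreducible_dyck q"
  shows "Ps = Qs"
  using assms
proof (induction Ps arbitrary: Qs)
  case Nil
  then show ?case by (cases Qs) (auto dest: irreducible_dyck_nonempty)
next
  case (Cons p Ps)
  then obtain q Qs' where Qs: "Qs = q # Qs'"
    by (cases Qs) (auto dest: irreducible_dyck_nonempty)
  have "p = q" using Cons.prems Qs irreducible_prefix_eq[of p q "concat Ps" "concat Qs'"] by simp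
  then show ?case using Cons.IH[of Qs'] Cons.prems Qs by simp
qed

lemma dyck_concat_irreducible:
  "dyck P \<Longrightarrow> \<exists>Ps. concat Ps = P \<and> (\<forall>p\<in>set Ps. irreducible_dyck p)"
proof (induction "length P" arbitrary: P rule: less_induct)
  case less
  show ?case
  proof (cases "P = []")
    case True
    then show ?thesis by (auto intro!: exI[of _ "[]"])
  next
    case False
    \<comment> \<open>The first return cuts off the first irreducible component.\<close>
    define m where "m = (LEAST i. 0 < i \<and> i \<le> length P \<and> height (take i P) = 0)"
    have ex: "0 < length P \<and> length P \<le> length P \<and> height (take (length P) P) = 0"
      using False less.prems by (simp add: dyck_def)
    have m: "0 < m \<and> m \<le> length P \<and> height (take m P) = 0"
      unfolding m_def using ex by (rule LeastI[where P = "\<lambda>i. 0 < i \<and> i \<le> length P \<and> height (take i P) = 0"])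
    have "0 < height (take i (take m P))" if "0 < i" "i < m" for i
    proof -
      have "height (take i P) \<noteq> 0"
        using not_less_Least[of i "\<lambda>i. 0 < i \<and> i \<le> length P \<and> height (take i P) = 0"] that m m_def by auto
      moreover have "0 \<le> height (take i P)" using less.prems that m by (simp add: dyck_def)
      ultimately show ?thesis using that by (simp add: min_def)
    qed
    then have i: "irreducible_dyck (take m P)"
      using m False by (auto simp: irreducible_dyck_iff_heights)
    have "dyck (drop m P)" using dyck_append_right[of "take m P" "drop m P"] less.prems m by simp
    then obtain Ps where "concat Ps = drop m P" "\<forall>p\<in>set Ps. irreducible_dyck p"
      using less.hyps[of "drop m P"] m False by auto
    then show ?thesis using i by (auto intro!: exI[of _ "take m P # Ps"])
  qed
qed

lemma components_concat:
  assumes "\<forall>p\<in>set Ps. irreducible_dyck p"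
  shows "components (concat Ps) = Ps"
  unfolding components_def
proof (rule the_equality)
  fix Qs assume "concat Qs = concat Ps \<and> (\<forall>p\<in>set Qs. irreducible_dyck p)"
  then show "Qs = Ps" using assms irreducible_concat_unique[of Qs Ps] by blast
qed (simp add: assms)

section \<open>Realizable pairs and skew sums\<close>

text \<open>For \<open>xs\<close> the complement of \<alpha> this is the reversal of \<alpha>, the
  word that \<open>mu\<close> reads. Being an involution on permutations, it exchanges the two
  paths, which gives \<open>realizable_sym\<close>.\<close>

definition revcomp :: "nat list \<Rightarrow> nat list" where
  "revcomp xs = rev (map (\<lambda>x. length xs + 1 - x) xs)"

text \<open>The list \<open>xs\<close> is the complement of the permutation \<open>\<alpha>\<close>, so that both \<open>\<lambda>(\<alpha>)\<close> and \<open>\<mu>(\<alpha>)\<close>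
  are values of \<open>mu_aux\<close> and the relation is visibly symmetric.\<close>

definition realizable :: "bool list \<Rightarrow> bool list \<Rightarrow> bool" where
  "realizable p q \<longleftrightarrow>
     (\<exists>xs. is_perm (length xs) xs \<and> mu_aux 0 xs = p \<and> mu_aux 0 (revcomp xs) = q)"

lemma is_perm_length: "is_perm n xs \<Longrightarrow> length xs = n"
  unfolding is_perm_def by (metis card_atLeastAtMost diff_Suc_1 distinct_card)

lemma complement_interval: "(\<lambda>x. Suc n - x) ` {1..n} = {1..n}"
proof
  show "{1..n} \<subseteq> (\<lambda>x. Suc n - x) ` {1..n}"
  proof
    fix x assume "x \<in> {1..n}"
    then show "x \<in> (\<lambda>x. Suc n - x) ` {1..n}" by (intro image_eqI[of _ _ "Suc n - x"]) auto
  qed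
qed auto

lemma is_perm_complement: "is_perm n xs \<Longrightarrow> is_perm n (map (\<lambda>x. n + 1 - x) xs)"
  using complement_interval[of n] by (auto simp: is_perm_def distinct_map inj_on_def)

lemma is_perm_rev: "is_perm n (rev xs) \<longleftrightarrow> is_perm n xs"
  by (simp add: is_perm_def)

lemma is_perm_revcomp: "is_perm n xs \<Longrightarrow> is_perm n (revcomp xs)"
  using is_perm_complement is_perm_length by (simp add: revcomp_def is_perm_rev)

lemma complement_complement:
  "is_perm n xs \<Longrightarrow> map ((\<lambda>x. n + 1 - x) \<circ> (\<lambda>x. n + 1 - x)) xs = xs"
  by (rule map_idI) (auto simp: is_perm_def)

lemma revcomp_revcomp: "is_perm n xs \<Longrightarrow> revcomp (revcomp xs) = xs"
  using complement_complement[of n xs] is_perm_length[of n xs]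
  by (simp add: revcomp_def rev_map)

lemma realizable_sym: "realizable p q \<Longrightarrow> realizable q p"
proof -
  assume "realizable p q"
  then obtain xs where xs: "is_perm (length xs) xs" "mu_aux 0 xs = p" "mu_aux 0 (revcomp xs) = q"
    unfolding realizable_def by blast
  have "length (revcomp xs) = length xs" by (simp add: revcomp_def)
  then show ?thesis
    using xs is_perm_revcomp[OF xs(1)] revcomp_revcomp[OF xs(1)] unfolding realizable_def
    by (intro exI[of _ "revcomp xs"]) simp
qed

lemma lam_aux_complement:
  "m \<le> Suc n \<Longrightarrow> \<forall>x\<in>set xs. x \<le> n \<Longrightarrow>
     lam_aux m xs = mu_aux (Suc n - m) (map (\<lambda>x. Suc n - x) xs)"
  by (induction xs arbitrary: m) auto

lemma ex_perm_iff_realizable: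
  assumes "dyck P" "semilength P = n"
  shows "(\<exists>\<alpha>. is_perm n \<alpha> \<and> lam \<alpha> = P \<and> mu \<alpha> = Q) \<longleftrightarrow> realizable P Q"
proof
  assume "\<exists>\<alpha>. is_perm n \<alpha> \<and> lam \<alpha> = P \<and> mu \<alpha> = Q"
  then obtain \<alpha> where a: "is_perm n \<alpha>" "lam \<alpha> = P" "mu \<alpha> = Q" by blast
  let ?xs = "map (\<lambda>x. n + 1 - x) \<alpha>"
  have "lam \<alpha> = mu_aux 0 ?xs"
    using lam_aux_complement[of "Suc n" n \<alpha>] a is_perm_length[OF a(1)]
    by (auto simp: lam_def is_perm_def)
  moreover have "mu \<alpha> = mu_aux 0 (revcomp ?xs)"
    using complement_complement[OF a(1)] is_perm_length[OF a(1)] by (simp add: mu_def revcomp_def)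
  moreover have "is_perm (length ?xs) ?xs"
    using is_perm_complement[OF a(1)] is_perm_length[OF a(1)] by simp
  ultimately show "realizable P Q" using a unfolding realizable_def by (intro exI[of _ ?xs]) simp
next
  assume "realizable P Q"
  then obtain xs where xs: "is_perm (length xs) xs" "mu_aux 0 xs = P" "mu_aux 0 (revcomp xs) = Q"
    unfolding realizable_def by blast
  have n: "length xs = n"
    using xs(2) count_mu_aux(1)[of 0 xs] assms dyck_counts(2)[of P] by (auto simp: dyck_def)
  then have p: "is_perm n xs" using xs(1) by simp
  let ?a = "map (\<lambda>x. n + 1 - x) xs"
  have pa: "is_perm n ?a" using is_perm_complement[OF p] by simp
  have "\<forall>x\<in>set ?a. x \<le> n" using pa by (auto simp: is_perm_def)
  then have "lam ?a = mu_aux 0 xs"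
    using lam_aux_complement[of "Suc n" n ?a] n complement_complement[OF p]
    by (simp add: lam_def)
  moreover have "mu ?a = mu_aux 0 (revcomp xs)" using n by (simp add: mu_def revcomp_def)
  ultimately show "\<exists>\<alpha>. is_perm n \<alpha> \<and> lam \<alpha> = P \<and> mu \<alpha> = Q" using pa xs by (intro exI[of _ ?a]) simp
qed

lemma fold_max_perm: "is_perm n xs \<Longrightarrow> fold max xs 0 = n"
proof -
  assume p: "is_perm n xs"
  have "fold max xs 0 = Max (set (0 # xs))" by (simp only: Max.set_eq_fold)
  also have "\<dots> = Max {0..n}"
    using p by (intro arg_cong[of _ _ Max]) (auto simp: is_perm_def)
  also have "\<dots> = n" by (rule Max_eqI) auto
  finally show ?thesis .
qed

text \<open>The first \<open>j + 1\<close> entries are distinct and positive, so their maximum is at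
  least \<open>j + 1\<close>.\<close>

lemma dyck_mu_aux:
  assumes p: "is_perm n xs"
  shows "dyck (mu_aux 0 xs)" "semilength (mu_aux 0 xs) = n"
proof -
  let ?P = "mu_aux 0 xs"
  have l: "length xs = n" using is_perm_length[OF p] .
  have h: "height ?P = 0" using count_mu_aux[of 0 xs] fold_max_perm[OF p] l by (simp add: height_def)
  have "j < rmax 0 xs ! j" if "j < length xs" for j
  proof -
    let ?S = "set (take (Suc j) xs)"
    have d: "distinct (take (Suc j) xs)" using p by (simp add: is_perm_def)
    have "card ?S = Suc j" using distinct_card[OF d] that by simp
    moreover have "?S \<subseteq> {1..Max (insert 0 ?S)}"
      using p set_take_subset[of "Suc j" xs] by (auto simp: is_perm_def)
    ultimately have "Suc j \<le> Max (insert 0 ?S)"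
      using card_mono[of "{1..Max (insert 0 ?S)}" ?S] by simp
    then show ?thesis using rmax_nth[OF that] by simp
  qed
  then show "dyck ?P" unfolding dyck_iff_ups ups_mu_aux using h by (simp add: length_rmax)
  show "semilength ?P = n" using dyck_counts(2)[OF h] count_mu_aux(1)[of 0 xs] l by simp
qed

lemma realizable_dyck:
  assumes "realizable p q"
  shows "dyck p" "dyck q" "semilength p = semilength q"
proof -
  obtain xs where xs: "is_perm (length xs) xs" "mu_aux 0 xs = p" "mu_aux 0 (revcomp xs) = q"
    using assms unfolding realizable_def by blast
  show "dyck p" "dyck q" "semilength p = semilength q"
    using dyck_mu_aux[OF xs(1)] dyck_mu_aux[OF is_perm_revcomp[OF xs(1)]] xs by simp_all
qed

section \<open>Skew sums of permutations\<close>

lemma is_perm_skew: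
  "is_perm a ys \<Longrightarrow> is_perm b zs \<Longrightarrow> is_perm (a + b) (ys @ map ((+) a) zs)"
proof -
  assume a: "is_perm a ys" "is_perm b zs"
  have "(+) a ` {1..b} = {a + 1..a + b}" by simp
  then show ?thesis using a by (auto simp: is_perm_def distinct_map)
qed

text \<open>Complementing turns a skew sum into a direct sum, and the reverse-complement of a direct
  sum has its blocks in the opposite order. Hence the components of the second path come out
  reversed, as in \<open>L'\<close>.\<close>

lemma revcomp_skew:
  assumes "is_perm a ys" "is_perm b zs"
  shows "revcomp (ys @ map ((+) a) zs) = revcomp zs @ map ((+) b) (revcomp ys)"
proof -
  have "length ys = a" "length zs = b" "\<forall>y\<in>set ys. y \<le> a"
    using assms is_perm_length by (auto simp: is_perm_def)
  then show ?thesis by (auto simp: revcomp_def rev_map Suc_diff_le)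
qed

lemma mu_aux_skew:
  assumes "is_perm a ys"
  shows "mu_aux 0 (ys @ map ((+) a) zs) = mu_aux 0 ys @ mu_aux 0 zs"
  using mu_aux_shift[of a 0 zs] fold_max_perm[OF assms] by (simp add: mu_aux_append)

lemma realizable_append:
  assumes "realizable p1 q1" "realizable p2 q2"
  shows "realizable (p1 @ p2) (q2 @ q1)"
proof -
  obtain ys where ys: "is_perm (length ys) ys" "mu_aux 0 ys = p1" "mu_aux 0 (revcomp ys) = q1"
    using assms unfolding realizable_def by blast
  obtain zs where zs: "is_perm (length zs) zs" "mu_aux 0 zs = p2" "mu_aux 0 (revcomp zs) = q2"
    using assms unfolding realizable_def by blast
  let ?xs = "ys @ map ((+) (length ys)) zs"
  have "is_perm (length ?xs) ?xs" using is_perm_skew[OF ys(1) zs(1)] by simp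
  moreover have "mu_aux 0 ?xs = p1 @ p2" using mu_aux_skew[OF ys(1)] ys zs by simp
  moreover have "mu_aux 0 (revcomp ?xs) = q2 @ q1"
    unfolding revcomp_skew[OF ys(1) zs(1)] mu_aux_skew[OF is_perm_revcomp[OF zs(1)]]
    using ys zs by simp
  ultimately show ?thesis unfolding realizable_def by blast
qed

lemma rmax_take: "rmax c (take k xs) = take k (rmax c xs)"
proof (induction xs arbitrary: c k)
  case (Cons x xs)
  then show ?case by (cases k) auto
qed simp

lemma le_fold_max: "x \<in> set xs \<Longrightarrow> x \<le> fold max xs (c::nat)"
proof -
  assume "x \<in> set xs"
  moreover have "fold max xs c = Max (set (c # xs))" by (simp only: Max.set_eq_fold)
  ultimately show ?thesis by simp
qed

text \<open>Where \<open>p1\<close> ends, \<open>a\<close> entries have been read and their running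
  maximum is \<open>a\<close>. Being distinct and positive they are exactly 1 to \<open>a\<close>,
  so \<open>xs\<close> splits there into a direct sum.\<close>

lemma realizable_split:
  assumes "realizable (p1 @ p2) q" "dyck p1"
  shows "\<exists>q1 q2. q = q2 @ q1 \<and> realizable p1 q1 \<and> realizable p2 q2"
proof -
  obtain xs where xs: "is_perm (length xs) xs" "mu_aux 0 xs = p1 @ p2" "mu_aux 0 (revcomp xs) = q"
    using assms unfolding realizable_def by blast
  define n where "n = length xs"
  define a where "a = semilength p1"
  define ys where "ys = take a xs"
  define zs where "zs = map (\<lambda>x. x - a) (drop a xs)"
  have cnt: "count_list p1 True = a" "count_list p1 False = a"
    using dyck_counts assms(2) by (auto simp: dyck_def a_def)
  have "rmax 0 xs = ups 0 p1 @ ups a p2"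
    using ups_mu_aux[of 0 xs] xs(2) cnt by (simp add: ups_append)
  then have "rmax 0 ys = ups 0 p1" using cnt by (simp add: ys_def rmax_take length_ups)
  then have mys: "mu_aux 0 ys = p1" using mu_aux_eq_iff[OF assms(2)] by simp
  then have fys: "fold max ys 0 = a" using count_mu_aux(2)[of 0 ys] cnt by simp
  have lys: "length ys = a" using count_mu_aux(1)[of 0 ys] cnt mys by simp
  then have an: "a \<le> n" by (simp add: ys_def n_def split: if_splits)
  have dys: "distinct ys" using xs(1) by (simp add: ys_def is_perm_def)
  have "set ys \<subseteq> {1..a}"
    using le_fold_max[of _ ys 0] fys xs(1) set_take_subset[of a xs] by (auto simp: ys_def is_perm_def)
  then have sys: "set ys = {1..a}"
    using card_subset_eq[of "{1..a}" "set ys"] distinct_card[OF dys] lys by simp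
  have pys: "is_perm a ys" using dys sys by (simp add: is_perm_def)
  have xs_split: "xs = ys @ drop a xs" by (simp add: ys_def)
  have "set (drop a xs) = {1..n} - {1..a}"
  proof -
    have "distinct (ys @ drop a xs)" "set (ys @ drop a xs) = {1..n}"
      using xs(1) xs_split by (simp_all add: is_perm_def n_def)
    then show ?thesis using sys by auto
  qed
  moreover have "{1..n} - {1..a} = {a + 1..n}" by auto
  ultimately have sd: "set (drop a xs) = {a + 1..n}" by (rule trans)
  have zd: "map ((+) a) zs = drop a xs"
    unfolding zs_def map_map by (rule map_idI) (simp add: sd)
  have "inj_on (\<lambda>x. x - a) {a + 1..n}" by (auto simp: inj_on_def)
  moreover have "(\<lambda>x. x - a) ` {a + 1..n} = {1..n - a}"
  proof -
    have "x \<in> (\<lambda>x. x - a) ` {a + 1..n}" if "x \<in> {1..n - a}" for x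
      by (rule image_eqI[of _ _ "x + a"]) (use that in auto)
    then show ?thesis by auto
  qed
  ultimately have pzs: "is_perm (n - a) zs"
    using xs(1) sd by (simp add: is_perm_def zs_def distinct_map)
  have x: "xs = ys @ map ((+) a) zs" using xs_split zd by simp
  have mzs: "mu_aux 0 zs = p2" using mu_aux_skew[OF pys, of zs] x xs(2) mys by simp
  have "q = mu_aux 0 (revcomp zs) @ mu_aux 0 (revcomp ys)"
    using xs(3) unfolding x revcomp_skew[OF pys pzs] mu_aux_skew[OF is_perm_revcomp[OF pzs]]
    by simp
  moreover have "realizable p1 (mu_aux 0 (revcomp ys))"
    unfolding realizable_def using pys mys is_perm_length[OF pys] by (intro exI[of _ ys]) simp
  moreover have "realizable p2 (mu_aux 0 (revcomp zs))"
    unfolding realizable_def using pzs mzs is_perm_length[OF pzs] by (intro exI[of _ zs]) simp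
  ultimately show ?thesis by blast
qed

lemma semilength_eq_0_iff: "dyck p \<Longrightarrow> semilength p = 0 \<longleftrightarrow> p = []"
  using dyck_counts(3)[of p] by (auto simp: dyck_def)

lemma irreducible_append:
  assumes "irreducible_dyck (p @ q)" "dyck p"
  shows "p = [] \<or> q = []"
proof (rule ccontr)
  assume "\<not> (p = [] \<or> q = [])"
  then have "0 < height (take (length p) (p @ q))"
    using assms(1) unfolding irreducible_dyck_iff_heights
    by (elim conjE allE[of _ "length p"]) simp
  then show False using assms(2) by (simp add: dyck_def)
qed

text \<open>Splitting \<open>p\<close> along the first component of \<open>q\<close> gives
  \<open>p = p2 @ p1\<close> with \<open>p1\<close> nonempty. Irreducibility leaves
  \<open>p2\<close> empty, and then \<open>q\<close> has no further component.\<close>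

lemma realizable_irreducible:
  assumes r: "realizable p q" and p: "irreducible_dyck p"
  shows "irreducible_dyck q"
proof -
  obtain Qs where Qs: "concat Qs = q" "\<forall>q\<in>set Qs. irreducible_dyck q"
    using dyck_concat_irreducible realizable_dyck(2)[OF r] by blast
  have "q \<noteq> []"
    using semilength_eq_0_iff realizable_dyck[OF r] irreducible_dyck_nonempty[OF p] by metis
  then obtain q1 Qs' where Q: "Qs = q1 # Qs'" using Qs by (cases Qs) auto
  have q1: "irreducible_dyck q1" using Q Qs by simp
  have "realizable (q1 @ concat Qs') p" using realizable_sym[OF r] Q Qs by simp
  then obtain p1 p2 where *: "p = p2 @ p1" "realizable q1 p1" "realizable (concat Qs') p2"
    using realizable_split irreducible_dyckD[OF q1] by blast
  have "p1 \<noteq> []"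
    using semilength_eq_0_iff realizable_dyck[OF *(2)] irreducible_dyck_nonempty[OF q1] by metis
  then have "p2 = []" using irreducible_append p * realizable_dyck(2)[OF *(3)] by blast
  then have "concat Qs' = []" using semilength_eq_0_iff realizable_dyck[OF *(3)] by metis
  then have "q = q1" using Q Qs(1) by (simp del: concat_eq_Nil_conv)
  then show ?thesis using q1 by simp
qed

lemma realizable_concat_iff:
  assumes "\<forall>p\<in>set Ps. irreducible_dyck p" "\<forall>q\<in>set Qs. irreducible_dyck q"
  shows "realizable (concat Ps) (concat (rev Qs)) \<longleftrightarrow> list_all2 realizable Ps Qs"
proof
  assume "list_all2 realizable Ps Qs"
  then show "realizable (concat Ps) (concat (rev Qs))"
  proof induction
    case Nil
    have "realizable [] []"
      unfolding realizable_def by (intro exI[of _ "[]"]) (simp add: is_perm_def revcomp_def)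
    then show ?case by simp
  next
    case (Cons p Ps q Qs)
    then show ?case using realizable_append[of p q "concat Ps" "concat (rev Qs)"] by simp
  qed
next
  assume "realizable (concat Ps) (concat (rev Qs))"
  then show "list_all2 realizable Ps Qs" using assms
  proof (induction Ps arbitrary: Qs)
    case Nil
    then have "concat (rev Qs) = []"
      using realizable_dyck[of "[]" "concat (rev Qs)"] semilength_eq_0_iff by (metis concat.simps(1))
    then show ?case using Nil(3) by (cases Qs) (auto dest: irreducible_dyck_nonempty)
  next
    case (Cons p Ps)
    have p: "irreducible_dyck p" using Cons.prems by simp
    obtain q1 q2 where q: "concat (rev Qs) = q2 @ q1" "realizable p q1" "realizable (concat Ps) q2"
      using realizable_split[of p "concat Ps" "concat (rev Qs)"] Cons.prems(1) irreducible_dyckD[OF p]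
      unfolding concat.simps by blast
    have q1: "irreducible_dyck q1" using realizable_irreducible[OF q(2) p] .
    obtain Ts where Ts: "concat Ts = q2" "\<forall>t\<in>set Ts. irreducible_dyck t"
      using dyck_concat_irreducible realizable_dyck(2)[OF q(3)] by blast
    \<comment> \<open>As \<open>q1\<close> is irreducible, unique factorization identifies it with
      the last component of \<open>concat (rev Qs)\<close>, which is the head of
      \<open>Qs\<close>.\<close>
    have "rev Qs = Ts @ [q1]"
      by (rule irreducible_concat_unique) (use q Ts q1 Cons.prems in auto)
    then have Qs: "Qs = q1 # rev Ts" by (simp add: rev_swap)
    have "list_all2 realizable Ps (rev Ts)"
      using Cons.IH[of "rev Ts"] q(3) Ts Cons.prems by simp
    then show ?case using Qs q(2) by simp
  qed
qed

section \<open>Ascent-descent codes\<close>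

text \<open>The lists hold partial sums of run lengths (continuing from \<open>a\<close> and \<open>d\<close>), including the
  final \<open>n\<close>, which an ascent-descent code omits.\<close>

fun block_path :: "nat \<Rightarrow> nat \<Rightarrow> nat list \<Rightarrow> nat list \<Rightarrow> bool list" where
  "block_path a d (A # As) (D # Ds) =
     replicate (A - a) True @ replicate (D - d) False @ block_path A D As Ds"
| "block_path a d _ _ = []"

fun diffs :: "nat \<Rightarrow> nat list \<Rightarrow> nat list" where
  "diffs a [] = []"
| "diffs a (x # xs) = (x - a) # diffs x xs"

lemma length_diffs: "length (diffs a xs) = length xs"
  by (induction xs arbitrary: a) auto

lemma runs_hd: "ys \<noteq> [] \<Longrightarrow> \<exists>k r. runs ys = (hd ys, k) # r"
  by (cases ys) (auto split: list.splits prod.splits)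

lemma runs_replicate_append:
  assumes "0 < k" "ys = [] \<or> hd ys \<noteq> x"
  shows "runs (replicate k x @ ys) = (x, k) # runs ys"
  using assms(1)
proof (induction k rule: nat_induct_non_zero)
  case 1
  show ?case
  proof (cases "ys = []")
    case False
    then obtain k r where "runs ys = (hd ys, k) # r" using runs_hd by blast
    then show ?thesis using assms(2) False by auto
  qed simp
qed simp

lemma hd_block_path:
  "sorted_wrt (<) (a # As) \<Longrightarrow> block_path a d As Ds = [] \<or> hd (block_path a d As Ds)"
  by (cases "(a, d, As, Ds)" rule: block_path.cases) auto

lemma runs_block_path:
  assumes "sorted_wrt (<) (a # As)" "sorted_wrt (<) (d # Ds)" "length As = length Ds"
  shows "ascents (block_path a d As Ds) = diffs a As \<and> descents (block_path a d As Ds) = diffs d Ds"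
  using assms
proof (induction a d As Ds rule: block_path.induct)
  case (1 a d A As D Ds)
  let ?r = "block_path A D As Ds"
  have r: "?r = [] \<or> hd ?r" using 1(2) by (intro hd_block_path) simp
  have "runs (replicate (D - d) False @ ?r) = (False, D - d) # runs ?r"
    using r 1(3) by (intro runs_replicate_append) auto
  moreover have "runs (replicate (A - a) True @ replicate (D - d) False @ ?r) =
      (True, A - a) # runs (replicate (D - d) False @ ?r)"
    using 1(2,3) by (intro runs_replicate_append) auto
  ultimately show ?case using 1 by (simp add: ascents_def descents_def)
qed (auto simp: ascents_def descents_def)

lemma sum_take_diffs:
  "sorted_wrt (<) (a # xs) \<Longrightarrow> i \<le> length xs \<Longrightarrow> a + sum_list (take i (diffs a xs)) = (a # xs) ! i"
proof (induction xs arbitrary: a i)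
  case (Cons x xs)
  show ?case
  proof (cases i)
    case (Suc j)
    have "x + sum_list (take j (diffs x xs)) = (x # xs) ! j" using Cons Suc by simp
    then show ?thesis using Cons.prems Suc by simp
  qed simp
qed simp

lemma psums_diffs: "sorted_wrt (<) (0 # xs) \<Longrightarrow> psums (diffs 0 xs) = butlast xs"
proof (rule nth_equalityI)
  fix i assume "sorted_wrt (<) (0 # xs)" and i: "i < length (psums (diffs 0 xs))"
  moreover have "Suc i < length xs" using i by (simp add: psums_def length_diffs)
  ultimately show "psums (diffs 0 xs) ! i = butlast xs ! i"
    using sum_take_diffs[of 0 xs "Suc i"] by (simp add: psums_def length_diffs nth_butlast)
qed (simp add: psums_def length_diffs)

lemma length_ups_block_path:
  "sorted_wrt (<) (d # Ds) \<Longrightarrow> length As = length Ds \<Longrightarrow>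
     d + length (ups a (block_path a d As Ds)) = last (d # Ds)"
proof (induction a d As Ds rule: block_path.induct)
  case (1 a d A As D Ds)
  have "D + length (ups A (block_path A D As Ds)) = last (D # Ds)" using 1 by simp
  moreover have "count_list (replicate k True) False = 0" "count_list (replicate k False) False = k" for k
    by (induction k) auto
  ultimately show ?case using 1(2) by (simp add: length_ups)
qed auto

text \<open>All down steps of one descent have the same number of up steps before them. The index
  \<open>i\<close> also counts the \<open>d\<close> earlier down steps, which \<open>ups\<close>
  does not list, whence \<open>i - d\<close>.\<close>

lemma ups_block_path:
  assumes "sorted_wrt (<) (a # As)" "sorted_wrt (<) (d # Ds)" "length As = length Ds"
    "l < length As" "(d # Ds) ! l \<le> i" "i < Ds ! l"
  shows "ups a (block_path a d As Ds) ! (i - d) = As ! l"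
  using assms
proof (induction a d As Ds arbitrary: l rule: block_path.induct)
  case (1 a d A As D Ds)
  have u: "ups a (block_path a d (A # As) (D # Ds)) = replicate (D - d) A @ ups A (block_path A D As Ds)"
    using 1(2) by (simp add: ups_replicate_True ups_replicate_False)
  show ?case
  proof (cases l)
    case 0
    then show ?thesis unfolding u using 1(6,7) by (simp add: nth_append diff_less_mono)
  next
    case (Suc m)
    have "D \<le> (D # Ds) ! m" using 1(3,4,5) Suc by (cases m) (auto intro: less_imp_le)
    then have "D \<le> i" "d < D" using 1(3,6) Suc by auto
    moreover have "ups A (block_path A D As Ds) ! (i - D) = As ! m"
      by (rule 1(1)) (use 1(2-7) Suc in auto)
    moreover from calculation have "\<not> i - d < D - d" "i - d - (D - d) = i - D" by linarith+
    ultimately show ?thesis unfolding u using Suc by (simp add: nth_append)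
  qed
qed auto

lemma ex_block_path:
  assumes "P \<noteq> []" "hd P" "\<not> last P"
  shows "\<exists>As Ds. P = block_path a d As Ds \<and> sorted_wrt (<) (a # As) \<and> sorted_wrt (<) (d # Ds) \<and>
     length As = length Ds \<and> As \<noteq> []"
  using assms
proof (induction "length P" arbitrary: P a d rule: less_induct)
  case less
  \<comment> \<open>Here \<open>k\<close> and \<open>m\<close> are the lengths of the first ascent
    and the first descent; the rest \<open>S\<close> is empty or starts with an up step
    again.\<close>
  define k where "k = length (takeWhile (\<lambda>b. b) P)"
  define R where "R = dropWhile (\<lambda>b. b) P"
  define m where "m = length (takeWhile Not R)"
  define S where "S = dropWhile Not R"
  have P: "P = replicate k True @ R"
  proof -
    have "takeWhile (\<lambda>b. b) P = replicate k True"
      by (rule replicate_eqI) (auto simp: k_def dest: set_takeWhileD)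
    then show ?thesis unfolding R_def by (metis takeWhile_dropWhile_id)
  qed
  have R: "R = replicate m False @ S"
  proof -
    have "takeWhile Not R = replicate m False"
      by (rule replicate_eqI) (auto simp: m_def dest: set_takeWhileD)
    then show ?thesis unfolding S_def by (metis takeWhile_dropWhile_id)
  qed
  have k: "0 < k" using less.prems unfolding k_def by (cases P) auto
  have "R \<noteq> []"
  proof
    assume "R = []"
    then have "last P \<in> set (replicate k True)" using P less.prems(1) last_in_set[of P] by simp
    then show False using less.prems(3) by simp
  qed
  moreover from this have "\<not> hd R" using hd_dropWhile[of "\<lambda>b. b" P] by (simp add: R_def)
  ultimately have m: "0 < m" unfolding m_def by (cases R) auto
  show ?case
  proof (cases "S = []")
    case True
    then have "P = block_path a d [a + k] [d + m]" using P R by simp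
    then show ?thesis using k m by (intro exI[of _ "[a + k]"] exI[of _ "[d + m]"]) auto
  next
    case False
    have "hd S" using hd_dropWhile[of Not R] False by (simp add: S_def)
    moreover have "\<not> last S" using less.prems(3) P R False by simp
    moreover have "length S < length P" using P R k by simp
    ultimately obtain As Ds where *: "S = block_path (a + k) (d + m) As Ds"
      "sorted_wrt (<) ((a + k) # As)" "sorted_wrt (<) ((d + m) # Ds)" "length As = length Ds" "As \<noteq> []"
      using less.hyps[OF _ False] by blast
    have "P = block_path a d ((a + k) # As) ((d + m) # Ds)" using P R * by simp
    moreover have "sorted_wrt (<) (a # (a + k) # As)" "sorted_wrt (<) (d # (d + m) # Ds)"
      using * k m by auto
    ultimately show ?thesis using *(4) by (intro exI[of _ "(a + k) # As"] exI[of _ "(d + m) # Ds"]) auto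
  qed
qed

section \<open>Codes of irreducible paths\<close>

definition valid_code :: "nat \<Rightarrow> nat list \<Rightarrow> nat list \<Rightarrow> bool" where
  "valid_code n A D \<longleftrightarrow> sorted_wrt (<) (0 # A @ [n]) \<and> sorted_wrt (<) (0 # D @ [n]) \<and>
     length A = length D \<and> (\<forall>l<length D. D ! l < A ! l)"

definition code_path :: "nat \<Rightarrow> nat list \<Rightarrow> nat list \<Rightarrow> bool list" where
  "code_path n A D = block_path 0 0 (A @ [n]) (D @ [n])"

lemma code_path_codes:
  assumes "sorted_wrt (<) (0 # A @ [n])" "sorted_wrt (<) (0 # D @ [n])" "length A = length D"
  shows "asc_code (code_path n A D) = A" "desc_code (code_path n A D) = D"
  using runs_block_path[of 0 "A @ [n]" 0 "D @ [n]"] psums_diffs[of "A @ [n]"]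
    psums_diffs[of "D @ [n]"] assms
  by (simp_all add: asc_code_def desc_code_def code_path_def)

lemma sorted_wrt_less_nth_mono:
  "sorted_wrt (<) (xs :: nat list) \<Longrightarrow> i \<le> j \<Longrightarrow> j < length xs \<Longrightarrow> xs ! i \<le> xs ! j"
  using sorted_wrt_iff_nth_less[of "(<)" xs] by (cases "i = j") (auto intro: less_imp_le)

text \<open>Dictionary between codes and \<open>ups\<close>: this list is a step function with the
  ascent sums and \<open>n\<close> as values, increasing exactly at the descent sums.
  \<open>L'\<close> acts on codes while permutations produce \<open>ups\<close> lists, so later
  arguments pass between them through these facts.\<close>

lemma ups_code_path:
  assumes A: "sorted_wrt (<) (0 # A @ [n])" and D: "sorted_wrt (<) (0 # D @ [n])"
    and len: "length A = length D" and u: "u = ups 0 (code_path n A D)"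
  shows "length u = n"
    and "\<And>i. i < n \<Longrightarrow> \<exists>l\<le>length D. (0 # D) ! l \<le> i \<and> i < (D @ [n]) ! l \<and> u ! i = (A @ [n]) ! l"
    and "\<And>l. l < length D \<Longrightarrow> u ! (D ! l - 1) = A ! l"
    and "\<And>d. 0 < d \<Longrightarrow> d < n \<Longrightarrow> d \<in> set D \<longleftrightarrow> u ! (d - 1) < u ! d"
    and "set u = insert n (set A)"
proof -
  show l: "length u = n"
    using length_ups_block_path[OF D, of "A @ [n]" 0] len u by (simp add: code_path_def)
  have cons: "(0 # D @ [n]) ! l = (0 # D) ! l" if "l \<le> length D" for l
    using that by (cases l) (auto simp: nth_append)
  have block: "u ! i = (A @ [n]) ! l"
    if "l \<le> length D" "(0 # D) ! l \<le> i" "i < (D @ [n]) ! l" for l i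
    using ups_block_path[OF A D, of l i] that len cons u by (simp add: code_path_def)
  have ex: "\<exists>l\<le>length D. (0 # D) ! l \<le> i \<and> i < (D @ [n]) ! l" if "i < n" for i
  proof -
    \<comment> \<open>The descent that contains the down step with index \<open>i\<close>.\<close>
    define l where "l = (LEAST l. i < (D @ [n]) ! l)"
    have w: "i < (D @ [n]) ! (length D)" using that by simp
    have 1: "i < (D @ [n]) ! l" unfolding l_def by (rule LeastI, rule w)
    have 2: "l \<le> length D" unfolding l_def by (rule Least_le, rule w)
    have "(0 # D) ! l \<le> i"
    proof (cases l)
      case (Suc m)
      then have "\<not> i < (D @ [n]) ! m" using not_less_Least[of m "\<lambda>l. i < (D @ [n]) ! l"] l_def by simp
      then show ?thesis using Suc 2 by (simp add: nth_append)
    qed simp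
    then show ?thesis using 1 2 by blast
  qed
  then show blk: "\<exists>l\<le>length D. (0 # D) ! l \<le> i \<and> i < (D @ [n]) ! l \<and> u ! i = (A @ [n]) ! l"
    if "i < n" for i using that block by blast
  have Dlt: "(0 # D @ [n]) ! i < (0 # D @ [n]) ! j" if "i < j" "j < length D + 2" for i j
    using D that unfolding sorted_wrt_iff_nth_less by simp
  have Alt: "(A @ [n]) ! i < (A @ [n]) ! j" if "i < j" "j \<le> length D" for i j
    using sorted_wrt_nth_less[of "(<)" "A @ [n]" i j] A that len by simp
  have Dl: "(0 # D) ! l < D ! l" if "l < length D" for l
    using Dlt[of l "Suc l"] cons[of l] that by (simp add: nth_append)
  show pre: "u ! (D ! l - 1) = A ! l" if "l < length D" for l
    using block[of l "D ! l - 1"] Dl[OF that] that len by (simp add: nth_append)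
  show "d \<in> set D \<longleftrightarrow> u ! (d - 1) < u ! d" if d: "0 < d" "d < n" for d
  proof
    assume "d \<in> set D"
    then obtain l where l: "l < length D" "d = D ! l" by (auto simp: in_set_conv_nth)
    have "d < (D @ [n]) ! Suc l" using Dlt[of "Suc l" "Suc (Suc l)"] l by (simp add: nth_append)
    then have "u ! d = (A @ [n]) ! Suc l" using block[of "Suc l" d] l by simp
    moreover have "u ! (d - 1) = (A @ [n]) ! l" using pre l len by (simp add: nth_append)
    ultimately show "u ! (d - 1) < u ! d" using Alt[of l "Suc l"] l by simp
  next
    assume less: "u ! (d - 1) < u ! d"
    obtain l where l: "l \<le> length D" "(0 # D) ! l \<le> d" "d < (D @ [n]) ! l" using ex[OF d(2)] by blast
    show "d \<in> set D"
    proof (rule ccontr)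
      assume nd: "d \<notin> set D"
      have "(0 # D) ! l \<noteq> d" using nd l(1) d by (cases l) auto
      then have "u ! (d - 1) = (A @ [n]) ! l" using block[of l "d - 1"] l by simp
      moreover have "u ! d = (A @ [n]) ! l" using block l by blast
      ultimately show False using less by simp
    qed
  qed
  show "set u = insert n (set A)"
  proof
    show "set u \<subseteq> insert n (set A)"
    proof
      fix x assume "x \<in> set u"
      then obtain i where i: "i < n" "x = u ! i" using l by (auto simp: in_set_conv_nth)
      then obtain l where "l \<le> length D" "x = (A @ [n]) ! l" using blk by blast
      then show "x \<in> insert n (set A)" using len nth_mem[of l "A @ [n]"] by simp
    qed
    have "A ! l \<in> set u" if "l < length A" for l
    proof -
      have "D ! l < n" "0 < D ! l" using D that len by (auto simp: sorted_wrt_append)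
      then have "D ! l - 1 < length u" using l by simp
      then show ?thesis using pre[of l] that len nth_mem by metis
    qed
    moreover have "n \<in> set u"
    proof -
      have n: "(0 # D) ! length D < n" using Dlt[of "length D" "Suc (length D)"] cons[of "length D"] by (simp add: nth_append)
      then have "u ! (n - 1) = n" using block[of "length D" "n - 1"] len by (simp add: nth_append)
      then show ?thesis using l n nth_mem[of "n - 1" u] by simp
    qed
    ultimately show "insert n (set A) \<subseteq> set u" by (auto simp: in_set_conv_nth[of _ A])
  qed
qed

lemma block_path_last: "sorted_wrt (<) (d # Ds) \<Longrightarrow> block_path a d As Ds = [] \<or> \<not> last (block_path a d As Ds)"
proof (induction a d As Ds rule: block_path.induct)
  case (1 a d A As D Ds)
  show ?case
  proof (cases "block_path A D As Ds = []")
    case True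
    have "0 < D - d" using 1(2) by simp
    then show ?thesis using True by auto
  next
    case False
    then show ?thesis using 1 by simp
  qed
qed auto

lemma code_path_irreducible:
  assumes "valid_code n A D"
  shows "irreducible_dyck (code_path n A D)" "semilength (code_path n A D) = n"
proof -
  let ?u = "ups 0 (code_path n A D)"
  have s: "sorted_wrt (<) (0 # A @ [n])" "sorted_wrt (<) (0 # D @ [n])" "length A = length D"
    and v: "\<And>l. l < length D \<Longrightarrow> D ! l < A ! l"
    using assms by (auto simp: valid_code_def)
  note U = ups_code_path[OF s refl]
  have n: "0 < n" using s by simp
  have last: "code_path n A D = [] \<or> \<not> last (code_path n A D)"
    using s block_path_last unfolding code_path_def by blast
  \<comment> \<open>In a block with \<open>l < length D\<close> one has
    \<open>Suc i \<le> D ! l\<close> and \<open>D ! l < A ! l\<close>, where \<open>A ! l\<close> is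
    the entry at \<open>i\<close>; in the last block that entry is \<open>n\<close>.\<close>
  have gt: "Suc i < ?u ! i" if "Suc i < n" for i
  proof -
    obtain l where l: "l \<le> length D" "i < (D @ [n]) ! l" "?u ! i = (A @ [n]) ! l"
      using U(2)[of i] \<open>Suc i < n\<close> by auto
    show ?thesis
    proof (cases "l < length D")
      case True
      then show ?thesis using l v[of l] s(3) by (simp add: nth_append)
    next
      case False
      then show ?thesis using l that s(3) by (simp add: nth_append)
    qed
  qed
  have "?u ! (n - 1) = n"
  proof -
    obtain l where l: "l \<le> length D" "n - 1 < (D @ [n]) ! l" "?u ! (n - 1) = (A @ [n]) ! l"
      using U(2)[of "n - 1"] n by auto
    have "\<not> l < length D"
    proof
      assume "l < length D"
      then have "(D @ [n]) ! l < n" using s(2) by (auto simp: sorted_wrt_append nth_append)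
      then show False using l by simp
    qed
    then show ?thesis using l s(3) by (simp add: nth_append)
  qed
  then show "irreducible_dyck (code_path n A D)" "semilength (code_path n A D) = n"
    using irreducible_dyckI_ups[OF last refl U(1) n] gt by auto
qed

lemma irreducible_code:
  assumes irr: "irreducible_dyck P" and n: "semilength P = n"
  shows "valid_code n (asc_code P) (desc_code P)" "P = code_path n (asc_code P) (desc_code P)"
proof -
  note I = irreducible_ups[OF irr n refl]
  obtain R where R: "P = True # R @ [False]" using irr irreducible_dyck_iff_lift by auto
  obtain As Ds where AD: "P = block_path 0 0 As Ds" "sorted_wrt (<) (0 # As)" "sorted_wrt (<) (0 # Ds)"
    "length As = length Ds" "As \<noteq> []"
    using ex_block_path[of P 0 0] R by auto
  obtain A a where A: "As = A @ [a]" using AD by (cases As rule: rev_cases) auto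
  obtain D d where D: "Ds = D @ [d]" using AD by (cases Ds rule: rev_cases) auto
  have d: "d = n"
    using length_ups_block_path[OF AD(3,4), of 0] I(2) AD(1) D by simp
  have a: "a = n"
  proof -
    have "(0 # Ds) ! length D < d"
      using sorted_wrt_nth_less[OF AD(3), of "length D" "Suc (length D)"] D by simp
    then have "d - 1 < d" "(0 # Ds) ! length D \<le> d - 1" by auto
    then have "ups 0 P ! (d - 1) = a"
      using ups_block_path[OF AD(2-4), of "length D" "d - 1"] AD(1,4) A D by (simp add: nth_append)
    then show ?thesis using I(4) d by simp
  qed
  have s: "sorted_wrt (<) (0 # A @ [n])" "sorted_wrt (<) (0 # D @ [n])" "length A = length D"
    using AD A D a d by auto
  have P: "P = code_path n A D" using AD A D a d by (simp add: code_path_def)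
  have codes: "asc_code P = A" "desc_code P = D" unfolding P using code_path_codes[OF s] by auto
  note U = ups_code_path[OF s, of "ups 0 P", folded P, OF refl]
  \<comment> \<open>The last down step of the descent, with index \<open>D ! l - 1\<close>, has
    \<open>A ! l\<close> up steps before it, and irreducibility bounds this number from
    below.\<close>
  have "D ! l < A ! l" if "l < length D" for l
  proof -
    have "0 < D ! l" "D ! l < n" using s(2) that by (auto simp: sorted_wrt_append)
    then show ?thesis using I(6)[of "D ! l - 1"] U(3)[OF that] by simp
  qed
  then show "valid_code n (asc_code P) (desc_code P)" using s codes by (simp add: valid_code_def)
  show "P = code_path n (asc_code P) (desc_code P)" using P codes by simp
qed

section \<open>The order on irreducible paths\<close>

text \<open>\<open>f\<close> and \<open>g\<close> give the indices of the entries that survive the deletions.\<close>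

definition code_embeds :: "nat list \<Rightarrow> nat list \<Rightarrow> nat list \<Rightarrow> nat list \<Rightarrow> bool" where
  "code_embeds A D A' D' \<longleftrightarrow> (\<exists>f g.
     (\<forall>l m. l < m \<longrightarrow> m < length A' \<longrightarrow> f l < f m \<and> g l < g m) \<and>
     (\<forall>l<length A'. f l < length A \<and> g l \<le> f l \<and> A' ! l = A ! f l \<and> D' ! l = D ! g l))"

lemma code_embedsI:
  assumes "\<And>l m. l < m \<Longrightarrow> m < length A' \<Longrightarrow> f l < f m \<and> g l < g m"
    "\<And>l. l < length A' \<Longrightarrow> f l < length A \<and> g l \<le> f l \<and> A' ! l = A ! f l \<and> D' ! l = D ! g l"
  shows "code_embeds A D A' D'"
  unfolding code_embeds_def by (rule exI[of _ f], rule exI[of _ g]) (use assms in blast)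

lemma length_del_at: "i < length xs \<Longrightarrow> length (del_at i xs) = length xs - 1"
  by (simp add: del_at_def)

lemma nth_del_at:
  "i < length xs \<Longrightarrow> l < length xs - 1 \<Longrightarrow> del_at i xs ! l = xs ! (if l < i then l else Suc l)"
  by (simp add: del_at_def nth_append)

lemma sorted_del_at:
  assumes "i < length A" "sorted_wrt (<) (0 # A @ [n :: nat])"
  shows "sorted_wrt (<) (0 # del_at i A @ [n])"
proof -
  have "A = take i A @ A ! i # drop (Suc i) A" using id_take_nth_drop[OF assms(1)] .
  then have "sorted_wrt (<) (0 # (take i A @ A ! i # drop (Suc i) A) @ [n])" using assms(2) by simp
  then show ?thesis by (simp add: del_at_def sorted_wrt_append ball_Un)
qed

lemma valid_code_del_at:
  assumes v: "valid_code n A D" and ij: "i \<le> j" "j < length D"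
  shows "valid_code n (del_at i A) (del_at j D)"
proof -
  have s: "sorted_wrt (<) (0 # A @ [n])" "sorted_wrt (<) (0 # D @ [n])" "length A = length D"
    and lt: "\<And>l. l < length D \<Longrightarrow> D ! l < A ! l"
    using v by (auto simp: valid_code_def)
  have "del_at j D ! l < del_at i A ! l" if l: "l < length (del_at j D)" for l
  proof -
    let ?a = "if l < i then l else Suc l" and ?d = "if l < j then l else Suc l"
    have l': "l < length D - 1" using l ij by (simp add: length_del_at)
    \<comment> \<open>From \<open>i \<le> j\<close> follows \<open>?d \<le> ?a\<close>: the ascent
      code starts to shift no later than the descent code does.\<close>
    have "D ! ?d < A ! ?d" using lt l' by simp
    also have "A ! ?d \<le> A ! ?a"
      by (rule sorted_wrt_less_nth_mono) (use s ij l' in \<open>auto simp: sorted_wrt_append\<close>)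
    finally show ?thesis using nth_del_at[of i A l] nth_del_at[of j D l] l' ij s(3) by simp
  qed
  then show ?thesis
    unfolding valid_code_def
    using sorted_del_at[OF _ s(1), of i] sorted_del_at[OF _ s(2), of j] s(3) ij
    by (simp del: sorted_wrt.simps add: length_del_at)
qed

lemma code_embeds_refl: "length A = length D \<Longrightarrow> code_embeds A D A D"
  unfolding code_embeds_def by (intro exI[of _ "\<lambda>l. l"]) auto

lemma code_embeds_trans:
  assumes "code_embeds A D A' D'" "code_embeds A' D' A'' D''"
  shows "code_embeds A D A'' D''"
proof -
  obtain f g where fg:
    "\<And>l m. l < m \<Longrightarrow> m < length A' \<Longrightarrow> f l < f m \<and> g l < g m"
    "\<And>l. l < length A' \<Longrightarrow> f l < length A \<and> g l \<le> f l \<and> A' ! l = A ! f l \<and> D' ! l = D ! g l"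
    using assms(1) unfolding code_embeds_def by blast
  obtain f' g' where fg':
    "\<And>l m. l < m \<Longrightarrow> m < length A'' \<Longrightarrow> f' l < f' m \<and> g' l < g' m"
    "\<And>l. l < length A'' \<Longrightarrow> f' l < length A' \<and> g' l \<le> f' l \<and> A'' ! l = A' ! f' l \<and> D'' ! l = D' ! g' l"
    using assms(2) unfolding code_embeds_def by blast
  have g'_less: "g' l < length A'" if "l < length A''" for l
    using fg'(2)[OF that] by simp
  have "g (g' l) \<le> f (f' l)" if "l < length A''" for l
  proof -
    have "g (g' l) \<le> g (f' l)"
      using fg(1)[of "g' l" "f' l"] fg'(2)[OF that] by (cases "g' l = f' l") auto
    also have "\<dots> \<le> f (f' l)" using fg(2)[of "f' l"] fg'(2)[OF that] by simp
    finally show ?thesis .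
  qed
  note gf = this
  show ?thesis
  proof (rule code_embedsI[where f = "\<lambda>l. f (f' l)" and g = "\<lambda>l. g (g' l)"])
    fix l m assume "l < m" "m < length A''"
    then show "f (f' l) < f (f' m) \<and> g (g' l) < g (g' m)"
      using fg(1)[of "f' l" "f' m"] fg(1)[of "g' l" "g' m"] fg'(1)[of l m] fg'(2)[of m] g'_less[of m]
      by simp
  next
    fix l assume "l < length A''"
    then show "f (f' l) < length A \<and> g (g' l) \<le> f (f' l) \<and> A'' ! l = A ! f (f' l) \<and> D'' ! l = D ! g (g' l)"
      using fg(2)[of "f' l"] fg(2)[of "g' l"] fg'(2)[of l] g'_less[of l] gf[of l] by simp
  qed
qed

lemma code_embeds_del_at:
  assumes "length A = length D" "i \<le> j" "j < length D"
  shows "code_embeds A D (del_at i A) (del_at j D)"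
  unfolding code_embeds_def
  by (rule exI[of _ "\<lambda>l. if l < i then l else Suc l"], rule exI[of _ "\<lambda>l. if l < j then l else Suc l"])
    (use assms in \<open>auto simp: length_del_at nth_del_at\<close>)

lemma irr_le_imp_code_embeds:
  assumes "irr_le P Q"
  shows "code_embeds (asc_code P) (desc_code P) (asc_code Q) (desc_code Q)"
proof -
  have "covers\<^sup>*\<^sup>* P Q" and P: "irreducible_dyck P" using assms by (auto simp: irr_le_def)
  from this(1) show ?thesis
  proof induction
    case base
    show ?case using irreducible_code(1)[OF P refl] code_embeds_refl by (simp add: valid_code_def)
  next
    case (step Q R)
    then obtain i j where ij: "i \<le> j" "j < length (desc_code Q)"
      "asc_code R = del_at i (asc_code Q)" "desc_code R = del_at j (desc_code Q)" "irreducible_dyck Q"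
      unfolding covers_def by blast
    then have "length (asc_code Q) = length (desc_code Q)"
      using irreducible_code(1)[OF _ refl] by (simp add: valid_code_def)
    then show ?case using code_embeds_trans[OF step.IH] code_embeds_del_at ij by simp
  qed
qed

lemma strict_mono_gap:
  fixes f :: "nat \<Rightarrow> nat"
  assumes "\<And>l m. l < m \<Longrightarrow> m < k \<Longrightarrow> f l < f m" "l \<le> m" "m < k"
  shows "f l + (m - l) \<le> f m"
  using assms(2,3)
proof (induction m rule: dec_induct)
  case (step m)
  have "f m < f (Suc m)" using assms(1)[of m "Suc m"] step by simp
  then show ?case using step by simp
qed simp

text \<open>Induction on the number of deletions still to make: delete the first index that
  \<open>f\<close> skips from the ascent code and the first that \<open>g\<close> skips from the
  descent code. As \<open>g \<le> f\<close> pointwise, \<open>g\<close> cannot skip an index before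
  \<open>f\<close> does, so this deletion is a cover. Subtracting 1 from the later values of
  \<open>f\<close> and \<open>g\<close> gives an embedding into the shorter code.\<close>

lemma code_embeds_imp_covers:
  assumes "valid_code n A D" "valid_code n A' D'" "code_embeds A D A' D'"
  shows "covers\<^sup>*\<^sup>* (code_path n A D) (code_path n A' D')"
  using assms
proof (induction "length A - length A'" arbitrary: A D rule: less_induct)
  case less
  define h where "h = length A"
  define k where "k = length A'"
  have len: "length D = h" "length A' = k" "length D' = k"
    using less.prems by (auto simp: valid_code_def h_def k_def)
  obtain f g where mono: "\<And>l m. l < m \<Longrightarrow> m < k \<Longrightarrow> f l < f m" "\<And>l m. l < m \<Longrightarrow> m < k \<Longrightarrow> g l < g m"
    and fg: "\<And>l. l < k \<Longrightarrow> f l < h" "\<And>l. l < k \<Longrightarrow> g l \<le> f l"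
       "\<And>l. l < k \<Longrightarrow> A' ! l = A ! f l" "\<And>l. l < k \<Longrightarrow> D' ! l = D ! g l"
    using less.prems(3) unfolding code_embeds_def h_def k_def by blast
  have ge: "l \<le> g l" if "l < k" for l
    using strict_mono_gap[of k g 0 l] mono(2) that by simp
  have le: "f l + k \<le> l + h" if "l < k" for l
  proof -
    have "f l + (k - 1 - l) \<le> f (k - 1)" by (rule strict_mono_gap[of k]) (use mono(1) that in auto)
    moreover have "f (k - 1) < h" using fg(1) that by simp
    ultimately show ?thesis using that by linarith
  qed
  have kh: "k \<le> h"
  proof (cases "k = 0")
    case False
    then show ?thesis using ge[of "k - 1"] fg(1,2)[of "k - 1"] by linarith
  qed simp
  show ?case
  proof (cases "h = k")
    case True
    have eq: "f l = l" "g l = l" if "l < k" for l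
      using ge[OF that] le[OF that] fg(2)[OF that] True by linarith+
    have "A' = A" by (rule nth_equalityI) (use eq fg len True h_def in auto)
    moreover have "D' = D" by (rule nth_equalityI) (use eq fg len True in auto)
    ultimately show ?thesis by simp
  next
    case False
    then have kh: "k < h" using kh by simp
    \<comment> \<open>A strictly increasing map fixes all indices before the first one it skips. The
      alternative \<open>l = k\<close> covers a map that is the identity below \<open>k\<close>;
      then \<open>k\<close>, which is less than \<open>h\<close>, is the first skipped
      index.\<close>
    define a where "a = (LEAST l. l = k \<or> f l \<noteq> l)"
    define b where "b = (LEAST l. l = k \<or> g l \<noteq> l)"
    have a: "a \<le> k" unfolding a_def by (rule Least_le) simp
    have b: "b \<le> k" unfolding b_def by (rule Least_le) simp
    have fa: "a = k \<or> f a \<noteq> a" unfolding a_def by (rule LeastI[of _ k]) simp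
    have gb: "b = k \<or> g b \<noteq> b" unfolding b_def by (rule LeastI[of _ k]) simp
    have f_below: "f l = l" if "l < a" for l
      using not_less_Least[of l "\<lambda>l. l = k \<or> f l \<noteq> l"] that a_def by simp
    have g_below: "g l = l" if "l < b" for l
      using not_less_Least[of l "\<lambda>l. l = k \<or> g l \<noteq> l"] that b_def by simp
    have f_above: "l < f l" if "a \<le> l" "l < k" for l
    proof -
      have "a < f a" using fa ge[of a] fg(2)[of a] that by auto
      then show ?thesis using strict_mono_gap[of k f a l] mono(1) that by simp
    qed
    have g_above: "l < g l" if "b \<le> l" "l < k" for l
    proof -
      have "b < g b" using gb ge[of b] that by auto
      then show ?thesis using strict_mono_gap[of k g b l] mono(2) that by simp
    qed
    have ab: "a \<le> b"
    proof (rule ccontr)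
      assume "\<not> a \<le> b"
      then have "g b \<le> b" "b < k" using f_below[of b] fg(2)[of b] a by auto
      then show False using g_above[of b] by simp
    qed
    define A1 where "A1 = del_at a A"
    define D1 where "D1 = del_at b D"
    have bD: "b < length D" using b kh len by simp
    have v1: "valid_code n A1 D1"
      using valid_code_del_at[OF less.prems(1) ab bD] by (simp add: A1_def D1_def)
    have ah: "a < h" using a kh by simp
    have lenA1: "length A1 = h - 1" using length_del_at[of a A] ah by (simp add: A1_def h_def)
    have emb: "code_embeds A1 D1 A' D'"
      unfolding code_embeds_def len(2)
    proof (rule exI[of _ "\<lambda>l. if l < a then l else f l - 1"],
        rule exI[of _ "\<lambda>l. if l < b then l else g l - 1"], intro conjI allI impI)
      fix l m assume lm: "l < m" "m < k"
      show "(if l < a then l else f l - 1) < (if m < a then m else f m - 1)"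
        using lm mono(1)[OF lm] f_above[of l] f_above[of m] by auto
      show "(if l < b then l else g l - 1) < (if m < b then m else g m - 1)"
        using lm mono(2)[OF lm] g_above[of l] g_above[of m] by auto
    next
      fix l assume l: "l < k"
      show f1: "(if l < a then l else f l - 1) < length A1"
        using l kh lenA1 fg(1)[OF l] f_above[of l] by auto
      show g1: "(if l < b then l else g l - 1) \<le> (if l < a then l else f l - 1)"
        using l ab fg(2)[OF l] f_above[of l] by auto
      show "A' ! l = A1 ! (if l < a then l else f l - 1)"
        using nth_del_at[of a A "if l < a then l else f l - 1"] f1 lenA1 ah fg(3)[OF l]
          f_below[of l] f_above[of l] l by (auto simp: A1_def h_def)
      have "(if l < b then l else g l - 1) < h - 1" using f1 g1 lenA1 by linarith
      then show "D' ! l = D1 ! (if l < b then l else g l - 1)"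
        using nth_del_at[of b D "if l < b then l else g l - 1"] bD len fg(4)[OF l]
          g_below[of l] g_above[of l] l by (auto simp: D1_def)
    qed
    have "covers\<^sup>*\<^sup>* (code_path n A1 D1) (code_path n A' D')"
      by (rule less.hyps) (use lenA1 h_def k_def kh v1 emb less.prems(2) in auto)
    moreover have "covers (code_path n A D) (code_path n A1 D1)"
    proof -
      have "asc_code (code_path n A D) = A" "desc_code (code_path n A D) = D"
        "asc_code (code_path n A1 D1) = A1" "desc_code (code_path n A1 D1) = D1"
        using code_path_codes less.prems(1) v1 unfolding valid_code_def by blast+
      then show ?thesis
        unfolding covers_def
        using code_path_irreducible[OF less.prems(1)] code_path_irreducible[OF v1] ab bD
        by (simp add: A1_def D1_def) blast
    qed
    ultimately show ?thesis by (rule converse_rtranclp_into_rtranclp[rotated])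
  qed
qed

lemma irr_le_iff_code_embeds:
  assumes "irreducible_dyck P" "irreducible_dyck Q" "semilength P = semilength Q"
  shows "irr_le P Q \<longleftrightarrow> code_embeds (asc_code P) (desc_code P) (asc_code Q) (desc_code Q)"
proof
  assume "code_embeds (asc_code P) (desc_code P) (asc_code Q) (desc_code Q)"
  then have "covers\<^sup>*\<^sup>* P Q"
    using code_embeds_imp_covers irreducible_code[OF assms(1) refl] irreducible_code[OF assms(2) assms(3)[symmetric]]
    by metis
  then show "irr_le P Q" using assms by (simp add: irr_le_def)
qed (rule irr_le_imp_code_embeds)

section \<open>Embeddings of codes in terms of counts\<close>

lemma card_less_nth:
  assumes "sorted_wrt (<) (xs :: nat list)" "l < length xs"
  shows "card {x \<in> set xs. x < xs ! l} = l"
proof -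
  have "{x \<in> set xs. x < xs ! l} = (\<lambda>i. xs ! i) ` {..<l}"
  proof (intro equalityI subsetI)
    fix x assume "x \<in> {x \<in> set xs. x < xs ! l}"
    then obtain i where "i < length xs" "x = xs ! i" "xs ! i < xs ! l" by (auto simp: in_set_conv_nth)
    then have "i < l" using sorted_wrt_less_nth_mono[OF assms(1), of l i] by (cases "i < l") auto
    then show "x \<in> (\<lambda>i. xs ! i) ` {..<l}" using \<open>x = xs ! i\<close> by auto
  next
    fix x assume "x \<in> (\<lambda>i. xs ! i) ` {..<l}"
    then show "x \<in> {x \<in> set xs. x < xs ! l}" using assms sorted_wrt_nth_less[OF assms(1)] by auto
  qed
  moreover have "inj_on (\<lambda>i. xs ! i) {..<l}"
    using assms by (intro inj_on_nth) (auto dest: strict_sorted_imp_sorted simp: strict_sorted_iff)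
  ultimately show ?thesis by (simp add: card_image)
qed

text \<open>Codes are strictly increasing, so \<open>f\<close> and \<open>g\<close> are forced: the
  index of an entry is the number of smaller entries. The requirement \<open>g l \<le> f l\<close>
  thus compares two cardinalities.\<close>

lemma code_embeds_iff:
  assumes s: "sorted_wrt (<) A" "sorted_wrt (<) D" "length A = length D"
    and s': "sorted_wrt (<) A'" "sorted_wrt (<) D'" "length A' = length D'"
  shows "code_embeds A D A' D' \<longleftrightarrow> set A' \<subseteq> set A \<and> set D' \<subseteq> set D \<and>
    (\<forall>l<length D'. card {x \<in> set D. x < D' ! l} \<le> card {x \<in> set A. x < A' ! l})"
proof
  assume "code_embeds A D A' D'"
  then obtain f g where fg:
    "\<And>l. l < length A' \<Longrightarrow> f l < length A \<and> g l \<le> f l \<and> A' ! l = A ! f l \<and> D' ! l = D ! g l"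
    unfolding code_embeds_def by blast
  have "set A' \<subseteq> set A"
  proof
    fix x assume "x \<in> set A'"
    then obtain l where "l < length A'" "x = A' ! l" by (auto simp: in_set_conv_nth)
    then show "x \<in> set A" using fg[of l] nth_mem[of "f l" A] by simp
  qed
  moreover have "set D' \<subseteq> set D"
  proof
    fix x assume "x \<in> set D'"
    then obtain l where "l < length A'" "x = D' ! l" using s' by (auto simp: in_set_conv_nth)
    then show "x \<in> set D" using fg[of l] s nth_mem[of "g l" D] by simp
  qed
  moreover have "card {x \<in> set D. x < D' ! l} \<le> card {x \<in> set A. x < A' ! l}" if "l < length D'" for l
    using fg[of l] card_less_nth[OF s(1), of "f l"] card_less_nth[OF s(2), of "g l"] that s s' by simp
  ultimately show "set A' \<subseteq> set A \<and> set D' \<subseteq> set D \<and>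
    (\<forall>l<length D'. card {x \<in> set D. x < D' ! l} \<le> card {x \<in> set A. x < A' ! l})" by blast
next
  assume R: "set A' \<subseteq> set A \<and> set D' \<subseteq> set D \<and>
    (\<forall>l<length D'. card {x \<in> set D. x < D' ! l} \<le> card {x \<in> set A. x < A' ! l})"
  define f where "f l = card {x \<in> set A. x < A' ! l}" for l
  define g where "g l = card {x \<in> set D. x < D' ! l}" for l
  have f: "f l < length A \<and> A' ! l = A ! f l" if "l < length A'" for l
  proof -
    have "A' ! l \<in> set A" using R that by auto
    then obtain i where "i < length A" "A' ! l = A ! i" by (metis in_set_conv_nth)
    then show ?thesis using card_less_nth[OF s(1)] by (simp add: f_def)
  qed
  have g: "g l < length D \<and> D' ! l = D ! g l" if "l < length A'" for l
  proof -
    have "D' ! l \<in> set D" using R that s' by auto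
    then obtain i where "i < length D" "D' ! l = D ! i" by (metis in_set_conv_nth)
    then show ?thesis using card_less_nth[OF s(2)] by (simp add: g_def)
  qed
  have "f l < f m \<and> g l < g m" if lm: "l < m" "m < length A'" for l m
  proof
    have "A ! f l < A ! f m" using f[of l] f[of m] lm sorted_wrt_nth_less[OF s'(1), of l m] by simp
    then show "f l < f m"
      using sorted_wrt_less_nth_mono[OF s(1), of "f m" "f l"] f[of l] lm by (cases "f l < f m") auto
    have "D ! g l < D ! g m" using g[of l] g[of m] lm s' sorted_wrt_nth_less[OF s'(2), of l m] by simp
    then show "g l < g m"
      using sorted_wrt_less_nth_mono[OF s(2), of "g m" "g l"] g[of l] lm by (cases "g l < g m") auto
  qed
  moreover have "g l \<le> f l" if "l < length A'" for l
    using R that s' by (simp add: f_def g_def)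
  ultimately show "code_embeds A D A' D'"
    using f g by (intro code_embedsI[of A' f g]) blast+
qed

section \<open>The map $L'$ on irreducible paths\<close>

text \<open>For the running maxima of a permutation these are the 0-based positions of its
  left-to-right maxima. They include position 0, whereas a descent code never contains 0.\<close>

definition jumps :: "nat list \<Rightarrow> nat set" where
  "jumps u = {i. i < length u \<and> (i = 0 \<or> u ! (i - 1) < u ! i)}"

lemma irreducible_code_ups:
  assumes irr: "irreducible_dyck P" and n: "semilength P = n" and u: "u = ups 0 P"
  shows "set (asc_code P) = set u - {n}" "set (desc_code P) = jumps u - {0}"
    "\<And>l. l < length (desc_code P) \<Longrightarrow> asc_code P ! l = u ! (desc_code P ! l - 1)"
proof -
  let ?A = "asc_code P" and ?D = "desc_code P"
  have s: "sorted_wrt (<) (0 # ?A @ [n])" "sorted_wrt (<) (0 # ?D @ [n])" "length ?A = length ?D"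
    using irreducible_code(1)[OF irr n] by (auto simp: valid_code_def)
  have u': "u = ups 0 (code_path n ?A ?D)" using irreducible_code(2)[OF irr n] u by simp
  note U = ups_code_path[OF s u']
  have "n \<notin> set ?A" using s by (auto simp: sorted_wrt_append)
  then show "set ?A = set u - {n}" using U(5) by blast
  have D: "0 < d \<and> d < n" if "d \<in> set ?D" for d using s(2) that by (auto simp: sorted_wrt_append)
  show "set ?D = jumps u - {0}"
  proof (intro set_eqI iffI)
    fix d assume "d \<in> set ?D"
    then show "d \<in> jumps u - {0}" using U(4)[of d] D[of d] U(1) by (simp add: jumps_def)
  next
    fix d assume "d \<in> jumps u - {0}"
    then show "d \<in> set ?D" using U(4)[of d] U(1) by (auto simp: jumps_def)
  qed
  show "?A ! l = u ! (?D ! l - 1)" if "l < length ?D" for l using U(3)[OF that] by simp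
qed

lemma mem_complement_image:
  fixes m :: nat
  assumes "S \<subseteq> {..m}" "x \<le> m"
  shows "x \<in> (\<lambda>y. m - y) ` S \<longleftrightarrow> m - x \<in> S"
proof
  assume "m - x \<in> S"
  then have "m - (m - x) \<in> (\<lambda>y. m - y) ` S" by (rule imageI)
  then show "x \<in> (\<lambda>y. m - y) ` S" using assms(2) diff_diff_cancel[of x m] by (simp del: diff_diff_left)
next
  assume "x \<in> (\<lambda>y. m - y) ` S"
  then obtain y where "y \<in> S" "x = m - y" by blast
  then show "m - x \<in> S" using assms(1) by auto
qed

lemma card_complement_image:
  fixes m :: nat
  assumes "S \<subseteq> {..m}"
  shows "card ((\<lambda>y. m - y) ` S) = card S"
proof (intro card_image inj_onI)
  fix x y assume "x \<in> S" "y \<in> S" "m - x = m - y"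
  moreover from this have "x \<le> m" "y \<le> m" using assms by auto
  ultimately show "x = y" by linarith
qed

lemma sorted_complement_list:
  assumes "finite S" "\<And>x. x \<in> S \<Longrightarrow> x \<le> (m :: nat)"
  shows "sorted_wrt (<) (map (\<lambda>x. m - x) (rev (sorted_list_of_set S)))"
    "set (map (\<lambda>x. m - x) (rev (sorted_list_of_set S))) = (\<lambda>x. m - x) ` S"
proof -
  have "sorted_wrt (\<lambda>y x. m - x < m - y) (sorted_list_of_set S)"
  proof (rule sorted_wrt_mono_rel[of _ "(<)"])
    fix x y assume "x \<in> set (sorted_list_of_set S)" "y \<in> set (sorted_list_of_set S)" "x < y"
    then show "m - y < m - x" using assms(1) assms(2)[of y] by auto
  qed simp
  then show "sorted_wrt (<) (map (\<lambda>x. m - x) (rev (sorted_list_of_set S)))"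
    by (simp add: sorted_wrt_map sorted_wrt_rev)
  show "set (map (\<lambda>x. m - x) (rev (sorted_list_of_set S))) = (\<lambda>x. m - x) ` S"
    using assms(1) by simp
qed

text \<open>In \<open>L'_irr\<close> a new ascent entry is \<open>x = n - a\<close>, where
  \<open>a\<close> is not a decremented old entry. So \<open>a + 1\<close>, which is
  \<open>n + 1 - x\<close>, must avoid \<open>A\<close>.\<close>

definition L'_asc :: "nat \<Rightarrow> nat set \<Rightarrow> nat set" where
  "L'_asc n A = {x. 2 \<le> x \<and> x < n \<and> n + 1 - x \<notin> A}"

definition L'_desc :: "nat \<Rightarrow> nat set \<Rightarrow> nat set" where
  "L'_desc n D = {x. 1 \<le> x \<and> x < n - 1 \<and> n - 1 - x \<notin> D}"

lemma valid_code_bounds: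
  assumes v: "valid_code n A D"
  shows "set A \<subseteq> {2..<n}" "set D \<subseteq> {1..<n - 1}" "card (set A) = card (set D)"
proof -
  have s: "sorted_wrt (<) (0 # A @ [n])" "sorted_wrt (<) (0 # D @ [n])" "length A = length D"
    and lt: "\<And>l. l < length D \<Longrightarrow> D ! l < A ! l"
    using v by (auto simp: valid_code_def)
  have b: "0 < D ! l \<and> A ! l < n" if "l < length D" for l
    using s that by (auto simp: sorted_wrt_append)
  have "A ! l \<in> {2..<n} \<and> D ! l \<in> {1..<n - 1}" if "l < length D" for l
    using b[OF that] lt[OF that] by auto
  then show "set A \<subseteq> {2..<n}" "set D \<subseteq> {1..<n - 1}" using s(3) by (auto simp: in_set_conv_nth)
  have "distinct A" "distinct D" using s by (auto simp: sorted_wrt_append strict_sorted_iff)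
  then show "card (set A) = card (set D)" using s(3) by (simp add: distinct_card)
qed

lemma card_code_ge:
  assumes v: "valid_code n A D"
  shows "card {d \<in> set D. s \<le> d} \<le> card {a \<in> set A. s < a}"
proof -
  let ?L = "{l. l < length D \<and> s \<le> D ! l}"
  have len: "length A = length D" and lt: "\<And>l. l < length D \<Longrightarrow> D ! l < A ! l"
    and dA: "distinct A"
    using v by (auto simp: valid_code_def sorted_wrt_append strict_sorted_iff)
  have "{d \<in> set D. s \<le> d} = (\<lambda>l. D ! l) ` ?L" by (auto simp: in_set_conv_nth)
  then have "card {d \<in> set D. s \<le> d} \<le> card ?L" by (simp add: card_image_le)
  also have "card ?L = card ((\<lambda>l. A ! l) ` ?L)"
    by (rule card_image[symmetric]) (rule inj_on_nth, use dA len in auto)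
  also have "\<dots> \<le> card {a \<in> set A. s < a}"
  proof (rule card_mono)
    show "(\<lambda>l. A ! l) ` ?L \<subseteq> {a \<in> set A. s < a}"
      using len lt by (auto intro: le_less_trans)
  qed simp
  finally show ?thesis .
qed

text \<open>Up to reflection, both sets arise from \<open>t - 1\<close> numbers by removing code
  entries: those of \<open>A\<close> above \<open>n - t\<close> and those of \<open>D\<close> from
  \<open>n - t\<close> on. Hence the inequality of \<open>card_code_ge\<close> turns around. It is
  what makes the code of \<open>L'_irr\<close> valid.\<close>

lemma card_L'_asc_le:
  assumes v: "valid_code n A D" and t: "1 \<le> t" "t < n - 1"
  shows "card {x \<in> L'_asc n (set A). x \<le> t} \<le> card {x \<in> L'_desc n (set D). x < t}"
proof -
  note b = valid_code_bounds[OF v]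
  let ?A = "{a \<in> set A. n - t < a}" and ?D = "{d \<in> set D. n - t \<le> d}"
  have "?A \<subseteq> {..n + 1}" using b(1) by auto
  note m = mem_complement_image[OF this] and c = card_complement_image[OF this]
  have "{x \<in> L'_asc n (set A). x \<le> t} = {2..t} - (\<lambda>a. n + 1 - a) ` ?A"
    using m t by (auto simp: L'_asc_def simp del: image_iff)
  moreover have "(\<lambda>a. n + 1 - a) ` ?A \<subseteq> {2..t}" using b(1) t by fastforce
  ultimately have cA: "card {x \<in> L'_asc n (set A). x \<le> t} = (t - 1) - card ?A"
    using c by (simp add: card_Diff_subset)
  have "?D \<subseteq> {..n - 1}" using b(2) by auto
  note m' = mem_complement_image[OF this] and c' = card_complement_image[OF this]
  have "{x \<in> L'_desc n (set D). x < t} = {1..<t} - (\<lambda>d. n - 1 - d) ` ?D"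
    using m' t by (auto simp: L'_desc_def simp del: image_iff)
  moreover have "(\<lambda>d. n - 1 - d) ` ?D \<subseteq> {1..<t}" using b(2) t by fastforce
  ultimately have cD: "card {x \<in> L'_desc n (set D). x < t} = (t - 1) - card ?D"
    using c' by (simp add: card_Diff_subset)
  show ?thesis unfolding cA cD using card_code_ge[OF v, of "n - t"] by simp
qed

lemma card_L'_asc_desc:
  assumes v: "valid_code n A D"
  shows "card (L'_asc n (set A)) = card (L'_desc n (set D))"
proof -
  note b = valid_code_bounds[OF v]
  have "set A \<subseteq> {..n + 1}" using b(1) by auto
  note m = mem_complement_image[OF this] and c = card_complement_image[OF this]
  have "L'_asc n (set A) = {2..<n} - (\<lambda>a. n + 1 - a) ` set A"
    using m by (auto simp: L'_asc_def simp del: image_iff)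
  moreover have "(\<lambda>a. n + 1 - a) ` set A \<subseteq> {2..<n}" using b(1) by fastforce
  ultimately have cA: "card (L'_asc n (set A)) = n - 2 - card (set A)"
    using c by (simp add: card_Diff_subset)
  have "set D \<subseteq> {..n - 1}" using b(2) by auto
  note m' = mem_complement_image[OF this] and c' = card_complement_image[OF this]
  have "L'_desc n (set D) = {1..<n - 1} - (\<lambda>d. n - 1 - d) ` set D"
    using m' by (auto simp: L'_desc_def simp del: image_iff)
  moreover have "(\<lambda>d. n - 1 - d) ` set D \<subseteq> {1..<n - 1}" using b(2) by fastforce
  ultimately have cD: "card (L'_desc n (set D)) = n - 2 - card (set D)"
    using c' by (simp add: card_Diff_subset)
  show ?thesis using cA cD b(3) by simp
qed

lemma L'_asc_eq: "set A \<subseteq> {2..<n} \<Longrightarrow> (\<lambda>x. n - x) ` ({1..n - 2} - (\<lambda>a. a - 1) ` set A) = L'_asc n (set A)"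
proof (intro set_eqI iffI)
  fix x assume b: "set A \<subseteq> {2..<n}" and "x \<in> (\<lambda>x. n - x) ` ({1..n - 2} - (\<lambda>a. a - 1) ` set A)"
  then obtain y where y: "y \<in> {1..n - 2}" "y \<notin> (\<lambda>a. a - 1) ` set A" "x = n - y" by blast
  have "y + 1 \<notin> set A" using y(2) by force
  moreover have "n + 1 - x = y + 1" using y by auto
  ultimately show "x \<in> L'_asc n (set A)" using y by (auto simp: L'_asc_def)
next
  fix x assume b: "set A \<subseteq> {2..<n}" and x: "x \<in> L'_asc n (set A)"
  have "n - x \<notin> (\<lambda>a. a - 1) ` set A"
  proof
    assume "n - x \<in> (\<lambda>a. a - 1) ` set A"
    then obtain a where a: "a \<in> set A" "n - x = a - 1" by blast
    then have "2 \<le> a" using b by auto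
    then have "a = n + 1 - x" using a x by (auto simp: L'_asc_def)
    then show False using a x by (simp add: L'_asc_def)
  qed
  then have "n - (n - x) \<in> (\<lambda>x. n - x) ` ({1..n - 2} - (\<lambda>a. a - 1) ` set A)"
    using x by (intro imageI) (auto simp: L'_asc_def)
  then show "x \<in> (\<lambda>x. n - x) ` ({1..n - 2} - (\<lambda>a. a - 1) ` set A)"
    using x by (simp add: L'_asc_def)
qed

lemma L'_desc_eq: "(\<lambda>x. n - 1 - x) ` ({1..n - 2} - set D) = L'_desc n (set D)"
proof (intro set_eqI iffI)
  fix x assume "x \<in> (\<lambda>x. n - 1 - x) ` ({1..n - 2} - set D)"
  then obtain y where y: "y \<in> {1..n - 2}" "y \<notin> set D" "x = n - 1 - y" by blast
  moreover have "n - 1 - x = y" using y by auto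
  ultimately show "x \<in> L'_desc n (set D)" by (auto simp: L'_desc_def)
next
  fix x assume x: "x \<in> L'_desc n (set D)"
  have "{1..n - 2} - set D \<subseteq> {..n - 1}" by auto
  from mem_complement_image[OF this, of x] x
  show "x \<in> (\<lambda>x. n - 1 - x) ` ({1..n - 2} - set D)" by (auto simp: L'_desc_def)
qed

lemma L'_irr_code:
  assumes irr: "irreducible_dyck Q" and n: "semilength Q = n"
  shows "irreducible_dyck (L'_irr Q)" "semilength (L'_irr Q) = n"
    "set (asc_code (L'_irr Q)) = L'_asc n (set (asc_code Q))"
    "set (desc_code (L'_irr Q)) = L'_desc n (set (desc_code Q))"
proof -
  let ?A = "asc_code Q" and ?D = "desc_code Q"
  have v: "valid_code n ?A ?D" using irreducible_code(1)[OF irr n] .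
  note b = valid_code_bounds[OF v]
  define A' where "A' = map (\<lambda>a. n - a) (rev (sorted_list_of_set ({1..n-2} - (\<lambda>a. a - 1) ` set ?A)))"
  define D' where "D' = map (\<lambda>d. n - 1 - d) (rev (sorted_list_of_set ({1..n-2} - set ?D)))"
  have sA: "sorted_wrt (<) A'" "set A' = L'_asc n (set ?A)"
    unfolding A'_def L'_asc_eq[OF b(1), symmetric]
    by (rule sorted_complement_list; auto)+
  have sD: "sorted_wrt (<) D'" "set D' = L'_desc n (set ?D)"
    unfolding D'_def L'_desc_eq[symmetric]
    by (rule sorted_complement_list; auto)+
  have len: "length A' = length D'"
    using card_L'_asc_desc[OF v] sA sD by (metis distinct_card strict_sorted_iff)
  have n0: "0 < n" using irreducible_ups(1)[OF irr n refl] .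
  have "\<forall>x\<in>set A'. 0 < x \<and> x < n" "\<forall>x\<in>set D'. 0 < x \<and> x < n"
    unfolding sA(2) sD(2) by (auto simp: L'_asc_def L'_desc_def)
  note bounds = this
  have v': "valid_code n A' D'"
    unfolding valid_code_def
  proof (intro conjI allI impI)
    show "sorted_wrt (<) (0 # A' @ [n])" "sorted_wrt (<) (0 # D' @ [n])"
      using sA(1) sD(1) bounds n0 by (simp_all add: sorted_wrt_append)
    show "length A' = length D'" by (rule len)
    fix l assume l: "l < length D'"
    \<comment> \<open>If \<open>A' ! l\<close> were at most \<open>t = D' ! l\<close>, then
      \<open>l + 1\<close> entries of \<open>A'\<close> would be at most \<open>t\<close>, while
      only \<open>l\<close> entries of \<open>D'\<close> lie below \<open>t\<close>.\<close>
    show "D' ! l < A' ! l"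
    proof (rule ccontr)
      define t where "t = D' ! l"
      assume "\<not> D' ! l < A' ! l"
      then have le: "A' ! l \<le> t" by (simp add: t_def)
      have "t \<in> L'_desc n (set ?D)" using nth_mem[OF l] sD(2) by (simp add: t_def)
      then have "card {x \<in> set A'. x \<le> t} \<le> card {x \<in> set D'. x < t}"
        using card_L'_asc_le[OF v, of t] sA(2) sD(2) by (simp add: L'_desc_def)
      also have "\<dots> = l" using card_less_nth[OF sD(1) l] by (simp add: t_def)
      finally have "card {x \<in> set A'. x \<le> t} \<le> l" .
      moreover have "card (insert (A' ! l) {x \<in> set A'. x < A' ! l}) \<le> card {x \<in> set A'. x \<le> t}"
        using le l len by (intro card_mono) auto
      moreover have "card (insert (A' ! l) {x \<in> set A'. x < A' ! l}) = Suc l"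
        using card_less_nth[OF sA(1), of l] l len by (subst card_insert_disjoint) auto
      ultimately show False by simp
    qed
  qed
  then have codes: "asc_code (code_path n A' D') = A'" "desc_code (code_path n A' D') = D'"
    using code_path_codes unfolding valid_code_def by blast+
  note cp = code_path_irreducible[OF v']
  have "L'_irr Q = (THE R. irreducible_dyck R \<and> semilength R = n \<and> asc_code R = A' \<and> desc_code R = D')"
    by (simp add: L'_irr_def Let_def n A'_def D'_def)
  also have "\<dots> = code_path n A' D'"
  proof (rule the_equality)
    fix R assume R: "irreducible_dyck R \<and> semilength R = n \<and> asc_code R = A' \<and> desc_code R = D'"
    then show "R = code_path n A' D'" using irreducible_code(2)[of R n] by simp
  qed (use cp codes in simp)
  finally have L: "L'_irr Q = code_path n A' D'" .
  show "irreducible_dyck (L'_irr Q)" "semilength (L'_irr Q) = n"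
    "set (asc_code (L'_irr Q)) = L'_asc n (set (asc_code Q))"
    "set (desc_code (L'_irr Q)) = L'_desc n (set (desc_code Q))"
    using cp codes sA sD by (simp_all add: L)
qed

text \<open>An entry \<open>x\<close> of \<open>u\<close> stands for the left-to-right minimum
  \<open>n + 1 - x\<close> of \<alpha>. An entry that is at once such a minimum and a right-to-left
  maximum has only larger entries before it and only smaller ones after it, so a skew-indecomposable
  permutation of at least two letters has none.\<close>

definition compatible :: "nat \<Rightarrow> nat list \<Rightarrow> nat list \<Rightarrow> bool" where
  "compatible n u w \<longleftrightarrow>
     (\<forall>x\<in>set u. \<forall>y\<in>set w. x + y \<noteq> n + 1) \<and> (\<forall>i\<in>jumps u. \<forall>j\<in>jumps w. i + j \<noteq> n - 1)"

text \<open>For \<open>u = ups 0 P\<close> and \<open>w = ups 0 Q\<close>, \<open>d\<close> is the 0-based position of a left-to-right minimum of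
  \<open>\<alpha>\<close>, \<open>n + 1 - u ! (d - 1)\<close> is the preceding minimum, and \<open>n - 1 - j\<close> and the members of \<open>w\<close> are
  the positions and values of the right-to-left maxima.\<close>

definition enough_values :: "nat \<Rightarrow> nat list \<Rightarrow> nat list \<Rightarrow> bool" where
  "enough_values n u w \<longleftrightarrow> (\<forall>d\<in>jumps u - {0}.
     card ({..<d} - (\<lambda>j. n - 1 - j) ` jumps w) \<le> card ({n + 1 - u ! (d - 1)..n} - set w))"

text \<open>The inclusions of the ascent and descent codes are the two halves of
  \<open>compatible\<close>. Given these, each cardinality in \<open>enough_values\<close> exceeds
  the corresponding one for the codes by exactly one, so the inequalities agree.\<close>

lemma irr_le_L'_iff:
  assumes p: "irreducible_dyck p" "semilength p = n" and q: "irreducible_dyck q" "semilength q = n"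
    and n: "2 \<le> n" and u: "u = ups 0 p" and w: "w = ups 0 q"
  shows "irr_le (L'_irr q) p \<longleftrightarrow> compatible n u w \<and> enough_values n u w"
proof -
  note L = L'_irr_code[OF q]
  note U = irreducible_ups[OF p u] and W = irreducible_ups[OF q w]
  note cU = irreducible_code_ups[OF p u] and cW = irreducible_code_ups[OF q w]
  have vp: "valid_code n (asc_code p) (desc_code p)" using irreducible_code(1)[OF p] .
  have vL: "valid_code n (asc_code (L'_irr q)) (desc_code (L'_irr q))"
    using irreducible_code(1)[OF L(1,2)] .
  \<comment> \<open>Irreducibility already forces \<open>v ! (n - 2) = n\<close>, so the list cannot
    increase at its last position.\<close>
  have last_jump: "n - 1 \<notin> jumps v" if "irreducible_dyck r" "semilength r = n" "v = ups 0 r" for v r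
  proof
    assume "n - 1 \<in> jumps v"
    then have "v ! (n - 2) < v ! (n - 1)" using n by (simp add: jumps_def numeral_2_eq_2)
    moreover have "Suc (n - 2) < v ! (n - 2)" "v ! (n - 1) = n"
      using irreducible_ups[OF that] n by auto
    ultimately show False using n by linarith
  qed
  have ge2: "2 \<le> x \<and> x \<le> n"
    if r: "irreducible_dyck r" "semilength r = n" "v = ups 0 r" and x: "x \<in> set v" for v r x
  proof -
    note V = irreducible_ups[OF r]
    obtain i where i: "i < n" "x = v ! i" using x V(2) by (auto simp: in_set_conv_nth)
    show ?thesis
    proof (cases "Suc i < n")
      case True
      then show ?thesis using V(5)[OF i(1)] V(6)[of i] i by simp
    next
      case False
      then have "i = n - 1" using i by simp
      then show ?thesis using V(4) i n by simp
    qed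
  qed
  note geu = ge2[OF p u] and gew = ge2[OF q w]
  note lju = last_jump[OF p u] and ljw = last_jump[OF q w]
  have jlt: "i < n" if "i \<in> jumps u \<or> i \<in> jumps w" for i
    using that U(2) W(2) by (auto simp: jumps_def)
  have cA: "set (asc_code p) \<subseteq> L'_asc n (set (asc_code q)) \<longleftrightarrow> (\<forall>x\<in>set u. \<forall>y\<in>set w. x + y \<noteq> n + 1)"
    (is "?l \<longleftrightarrow> ?r")
  proof
    assume l: ?l
    show ?r
    proof (intro ballI notI)
      fix x y assume xy: "x \<in> set u" "y \<in> set w" "x + y = n + 1"
      then have "x \<noteq> n" using gew[of y] by auto
      then have "x \<in> L'_asc n (set (asc_code q))" using l xy(1) cU(1) by blast
      moreover have "n + 1 - x = y" using xy by simp
      ultimately have "y \<notin> set w - {n}" "2 \<le> x" by (auto simp: L'_asc_def cW(1))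
      then show False using xy by auto
    qed
  next
    assume r: ?r
    show ?l
    proof
      fix x assume "x \<in> set (asc_code p)"
      then have x: "x \<in> set u" "x \<noteq> n" using cU(1) by auto
      have "n + 1 - x \<notin> set w"
      proof
        assume "n + 1 - x \<in> set w"
        then show False using r x(1) geu[OF x(1)] by fastforce
      qed
      then show "x \<in> L'_asc n (set (asc_code q))" using x geu[of x] by (auto simp: L'_asc_def cW(1))
    qed
  qed
  have cD: "set (desc_code p) \<subseteq> L'_desc n (set (desc_code q)) \<longleftrightarrow> (\<forall>i\<in>jumps u. \<forall>j\<in>jumps w. i + j \<noteq> n - 1)"
    (is "?l \<longleftrightarrow> ?r")
  proof
    assume l: ?l
    show ?r
    proof (intro ballI notI)
      fix i j assume ij: "i \<in> jumps u" "j \<in> jumps w" "i + j = n - 1"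
      have "i \<noteq> 0"
      proof
        assume "i = 0"
        then have "j = n - 1" using ij by simp
        then show False using ij(2) ljw by simp
      qed
      then have "i \<in> L'_desc n (set (desc_code q))" using l ij(1) cU(2) by blast
      moreover have "n - 1 - i = j" using ij by simp
      ultimately have "j \<notin> jumps w - {0}" "i < n - 1" by (auto simp: L'_desc_def cW(2))
      then show False using ij by auto
    qed
  next
    assume r: ?r
    show ?l
    proof
      fix i assume "i \<in> set (desc_code p)"
      then have i: "i \<in> jumps u" "i \<noteq> 0" using cU(2) by auto
      then have "i < n - 1" using lju jlt[of i] by (cases "i = n - 1") auto
      moreover have "n - 1 - i \<notin> jumps w"
      proof
        assume "n - 1 - i \<in> jumps w"
        then show False using r i(1) \<open>i < n - 1\<close> by fastforce
      qed
      ultimately show "i \<in> L'_desc n (set (desc_code q))" using i by (auto simp: L'_desc_def cW(2))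
    qed
  qed
  have count: "(\<forall>l<length (desc_code p).
       card {x \<in> L'_desc n (set (desc_code q)). x < desc_code p ! l}
         \<le> card {x \<in> L'_asc n (set (asc_code q)). x < asc_code p ! l}) \<longleftrightarrow> enough_values n u w"
    if c: "compatible n u w"
  proof -
    have step: "card {x \<in> L'_desc n (set (desc_code q)). x < d}
        \<le> card {x \<in> L'_asc n (set (asc_code q)). x < u ! (d - 1)} \<longleftrightarrow>
       card ({..<d} - (\<lambda>j. n - 1 - j) ` jumps w) \<le> card ({n + 1 - u ! (d - 1)..n} - set w)"
      if d: "d \<in> jumps u - {0}" for d
    proof -
      define a where "a = u ! (d - 1)"
      have dn: "d < n - 1" using lju jlt[of d] d by (cases "d = n - 1") auto
      have au: "a \<in> set u" using dn U(2) by (simp add: a_def)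
      have "jumps w \<subseteq> {..n - 1}" using jlt by fastforce
      note inJ = mem_complement_image[OF this]
      \<comment> \<open>The extra element is position 0. It holds no right-to-left maximum because
        \<open>n - 1\<close> is no jump of \<open>w\<close>, while descent codes start at 1.\<close>
      have "{..<d} - (\<lambda>j. n - 1 - j) ` jumps w = insert 0 {x \<in> L'_desc n (set (desc_code q)). x < d}"
      proof (intro set_eqI)
        fix x
        show "x \<in> {..<d} - (\<lambda>j. n - 1 - j) ` jumps w \<longleftrightarrow>
           x \<in> insert 0 {x \<in> L'_desc n (set (desc_code q)). x < d}"
        proof (cases "x < d")
          case True
          then have "x < n" using dn by simp
          show ?thesis
          proof (cases "x = 0")
            case True
            then show ?thesis using inJ[of 0] ljw d n by auto
          next
            case False
            then show ?thesis using inJ[of x] \<open>x < d\<close> dn by (auto simp: L'_desc_def cW(2))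
          qed
        qed (use d in auto)
      qed
      then have 1: "card ({..<d} - (\<lambda>j. n - 1 - j) ` jumps w) =
          Suc (card {x \<in> L'_desc n (set (desc_code q)). x < d})"
        by (simp add: L'_desc_def)
      have aw: "n + 1 - a \<notin> set w"
      proof
        assume "n + 1 - a \<in> set w"
        then have "a + (n + 1 - a) \<noteq> n + 1" using c au unfolding compatible_def by blast
        then show False using geu[OF au] by simp
      qed
      \<comment> \<open>Here the extra element is the preceding minimum \<open>n + 1 - a\<close>
        itself, which the strict bound \<open>x < a\<close> leaves out. Compatibility keeps it out
        of \<open>w\<close>.\<close>
      have "{n + 1 - a..n} - set w =
         insert (n + 1 - a) ((\<lambda>x. n + 1 - x) ` {x \<in> L'_asc n (set (asc_code q)). x < a})"
      proof (intro set_eqI)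
        fix v
        show "v \<in> {n + 1 - a..n} - set w \<longleftrightarrow>
           v \<in> insert (n + 1 - a) ((\<lambda>x. n + 1 - x) ` {x \<in> L'_asc n (set (asc_code q)). x < a})"
        proof
          assume v: "v \<in> {n + 1 - a..n} - set w"
          show "v \<in> insert (n + 1 - a) ((\<lambda>x. n + 1 - x) ` {x \<in> L'_asc n (set (asc_code q)). x < a})"
          proof (cases "v = n + 1 - a")
            case False
            have "n \<in> set w" using W(2,4) n by (metis diff_less nth_mem zero_less_one W(1))
            then have "v \<noteq> n" using v by auto
            then have "n + 1 - v \<in> {x \<in> L'_asc n (set (asc_code q)). x < a}"
              using v False geu[OF au] by (auto simp: L'_asc_def cW(1))
            then have "n + 1 - (n + 1 - v) \<in> (\<lambda>x. n + 1 - x) ` {x \<in> L'_asc n (set (asc_code q)). x < a}"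
              by (rule imageI)
            then show ?thesis using v by simp
          qed simp
        next
          assume "v \<in> insert (n + 1 - a) ((\<lambda>x. n + 1 - x) ` {x \<in> L'_asc n (set (asc_code q)). x < a})"
          then consider "v = n + 1 - a" | x where "x \<in> L'_asc n (set (asc_code q))" "x < a" "v = n + 1 - x"
            by blast
          then show "v \<in> {n + 1 - a..n} - set w"
          proof cases
            case 1
            then show ?thesis using aw geu[OF au] by auto
          next
            case 2
            then show ?thesis using geu[OF au] by (auto simp: L'_asc_def cW(1))
          qed
        qed
      qed
      moreover have "card (insert (n + 1 - a) ((\<lambda>x. n + 1 - x) ` {x \<in> L'_asc n (set (asc_code q)). x < a}))
         = Suc (card {x \<in> L'_asc n (set (asc_code q)). x < a})"
      proof -
        let ?S = "{x \<in> L'_asc n (set (asc_code q)). x < a}"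
        have "inj_on (\<lambda>x. n + 1 - x) ?S" by (auto simp: inj_on_def L'_asc_def)
        moreover have "n + 1 - a \<notin> (\<lambda>x. n + 1 - x) ` ?S" using geu[OF au] by (auto simp: L'_asc_def)
        moreover have "finite ?S" by (auto simp: L'_asc_def)
        ultimately show ?thesis by (simp add: card_image)
      qed
      ultimately have 2: "card ({n + 1 - a..n} - set w) = Suc (card {x \<in> L'_asc n (set (asc_code q)). x < a})"
        by simp
      show ?thesis using 1 2 by (simp add: a_def)
    qed
    have "(\<forall>l<length (desc_code p).
       card {x \<in> L'_desc n (set (desc_code q)). x < desc_code p ! l}
         \<le> card {x \<in> L'_asc n (set (asc_code q)). x < asc_code p ! l}) \<longleftrightarrow>
      (\<forall>d\<in>set (desc_code p). card {x \<in> L'_desc n (set (desc_code q)). x < d}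
        \<le> card {x \<in> L'_asc n (set (asc_code q)). x < u ! (d - 1)})"
      using cU(3) by (auto simp: all_set_conv_all_nth)
    then show ?thesis using step cU(2) by (simp add: enough_values_def)
  qed
  have s: "sorted_wrt (<) (asc_code r)" "sorted_wrt (<) (desc_code r)" "length (asc_code r) = length (desc_code r)"
    if "valid_code n (asc_code r) (desc_code r)" for r
    using that by (auto simp: valid_code_def sorted_wrt_append)
  have "irr_le (L'_irr q) p \<longleftrightarrow>
     set (asc_code p) \<subseteq> L'_asc n (set (asc_code q)) \<and> set (desc_code p) \<subseteq> L'_desc n (set (desc_code q)) \<and>
     (\<forall>l<length (desc_code p).
       card {x \<in> L'_desc n (set (desc_code q)). x < desc_code p ! l}
         \<le> card {x \<in> L'_asc n (set (asc_code q)). x < asc_code p ! l})"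
    using irr_le_iff_code_embeds[OF L(1) p(1)] L(2) p(2) code_embeds_iff[OF s[OF vL] s[OF vp]] L(3,4)
    by simp
  then show ?thesis using cA cD count by (auto simp: compatible_def)
qed

section \<open>Realizable pairs of irreducible paths\<close>

lemma rmax_Suc: "Suc i < length xs \<Longrightarrow> rmax c xs ! Suc i = max (rmax c xs ! i) (xs ! Suc i)"
proof (induction xs arbitrary: c i)
  case (Cons x xs)
  show ?case
  proof (cases i)
    case 0
    then show ?thesis using Cons.prems by (cases xs) auto
  next
    case (Suc j)
    then show ?thesis using Cons by simp
  qed
qed simp

lemma rmax_0: "xs \<noteq> [] \<Longrightarrow> rmax c xs ! 0 = max c (xs ! 0)"
  by (cases xs) auto

lemma nth_le_rmax: "i \<le> m \<Longrightarrow> m < length xs \<Longrightarrow> xs ! i \<le> rmax c xs ! m"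
proof -
  assume "i \<le> m" "m < length xs"
  then have "take (Suc m) xs ! i \<in> set (take (Suc m) xs)" by (intro nth_mem) simp
  then have "xs ! i \<in> set (take (Suc m) xs)" using \<open>i \<le> m\<close> by simp
  then show ?thesis using rmax_nth[OF \<open>m < length xs\<close>, of c] by simp
qed

lemma rmax_attained:
  assumes "0 \<notin> set xs" "m < length xs"
  shows "\<exists>i\<le>m. rmax 0 xs ! m = xs ! i"
proof -
  let ?S = "set (take (Suc m) xs)"
  have "xs ! 0 \<in> ?S" using assms(2) by (cases xs) auto
  then have ne: "?S \<noteq> {}" "\<exists>x\<in>?S. 0 < x" using assms(1) set_take_subset[of "Suc m" xs]
    by (auto intro!: bexI[of _ "xs ! 0"] gr0I)
  have "Max (insert 0 ?S) \<in> insert 0 ?S" by (rule Max_in) auto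
  moreover have "0 < Max (insert 0 ?S)" using ne(2) by (auto simp: Max_gr_iff)
  ultimately have "Max (insert 0 ?S) \<in> ?S" by (metis insert_iff less_irrefl)
  then obtain i where "i < length (take (Suc m) xs)" "Max (insert 0 ?S) = take (Suc m) xs ! i"
    by (metis in_set_conv_nth)
  then show ?thesis using rmax_nth[OF assms(2), of 0] by (intro exI[of _ i]) auto
qed

text \<open>As the entries are distinct, none can merely repeat an earlier maximum: an entry equals
  the running maximum exactly when it raises it.\<close>

lemma jumps_rmax_iff:
  assumes "distinct xs" "0 \<notin> set xs" "i < length xs"
  shows "i \<in> jumps (rmax 0 xs) \<longleftrightarrow> rmax 0 xs ! i = xs ! i"
proof (cases i)
  case 0
  then show ?thesis using assms rmax_0[of xs 0] by (auto simp: jumps_def length_rmax)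
next
  case (Suc k)
  have m: "rmax 0 xs ! i = max (rmax 0 xs ! k) (xs ! i)" using rmax_Suc[of k xs 0] assms Suc by simp
  obtain l where "l \<le> k" "rmax 0 xs ! k = xs ! l" using rmax_attained[of xs k] assms Suc by auto
  then have "rmax 0 xs ! k \<noteq> xs ! i" using assms Suc by (simp add: nth_eq_iff_index_eq)
  then show ?thesis using m assms Suc by (auto simp: jumps_def length_rmax)
qed

lemma rmax_value_at_jump:
  assumes "distinct xs" "0 \<notin> set xs" "x \<in> set (rmax 0 xs)"
  shows "\<exists>i\<in>jumps (rmax 0 xs). i < length xs \<and> x = xs ! i"
proof -
  obtain m where m: "m < length xs" "x = rmax 0 xs ! m"
    using assms(3) by (auto simp: in_set_conv_nth length_rmax)
  obtain i where i: "i \<le> m" "x = xs ! i" using rmax_attained[OF assms(2) m(1)] m(2) by auto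
  have "xs ! i \<le> rmax 0 xs ! i" using nth_le_rmax[of i i xs 0] i m by simp
  moreover have "rmax 0 xs ! i \<le> rmax 0 xs ! m"
  proof -
    obtain l where "l \<le> i" "rmax 0 xs ! i = xs ! l"
      using rmax_attained[OF assms(2), of i] i m by auto
    then show ?thesis using nth_le_rmax[of l m xs 0] i m by simp
  qed
  ultimately have "rmax 0 xs ! i = xs ! i" using i m by simp
  then show ?thesis using jumps_rmax_iff[OF assms(1,2), of i] i m by (intro bexI[of _ i]) auto
qed

text \<open>An entry of the complement at position \<open>i\<close> is at most
  \<open>ups 0 p ! i\<close> and at least \<open>n + 1 - ups 0 q ! (n - 1 - i)\<close>;
  irreducibility makes the lower bound strictly smaller. Strictly inside, the two summands are at
  least \<open>i + 2\<close> and \<open>n - i + 1\<close>; at either end one is \<open>n\<close> and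
  the other at least 2.\<close>

lemma irreducible_ups_sum:
  assumes p: "irreducible_dyck p" "semilength p = n" and q: "irreducible_dyck q" "semilength q = n"
    and n: "2 \<le> n" and i: "i < n"
  shows "n + 1 < ups 0 p ! i + ups 0 q ! (n - 1 - i)"
proof -
  note U = irreducible_ups[OF p refl] and W = irreducible_ups[OF q refl]
  consider "i = 0" | "i = n - 1" "i \<noteq> 0" | "0 < i" "Suc i < n" using i by linarith
  then show ?thesis
  proof cases
    case 1
    then show ?thesis using U(6)[of 0] W(4) n by simp
  next
    case 2
    then show ?thesis using U(4) W(6)[of 0] n by simp
  next
    case 3
    have "i + 1 < ups 0 p ! i" using U(6)[of i] 3 by simp
    moreover have "n - i < ups 0 q ! (n - 1 - i)"
    proof -
      have "Suc (n - 1 - i) < n" using 3 by linarith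
      then have "Suc (n - 1 - i) < ups 0 q ! (n - 1 - i)" by (rule W(6))
      then show ?thesis using 3 by simp
    qed
    ultimately show ?thesis using i by linarith
  qed
qed

lemma nth_revcomp: "j < length xs \<Longrightarrow> revcomp xs ! j = length xs + 1 - xs ! (length xs - 1 - j)"
  by (simp add: revcomp_def rev_nth)

lemma realized_conditions:
  assumes x: "is_perm n xs" and p: "irreducible_dyck (mu_aux 0 xs)"
    and q: "irreducible_dyck (mu_aux 0 (revcomp xs))" and n: "2 \<le> n"
    and u: "u = ups 0 (mu_aux 0 xs)" and w: "w = ups 0 (mu_aux 0 (revcomp xs))"
  shows "compatible n u w" "enough_values n u w"
proof -
  let ?ys = "revcomp xs"
  have y: "is_perm n ?ys" using is_perm_revcomp[OF x] .
  have len: "length xs = n" "length ?ys = n" using is_perm_length x y by auto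
  have u': "u = rmax 0 xs" and w': "w = rmax 0 ?ys" using u w by (simp_all add: ups_mu_aux)
  have dx: "distinct xs" "0 \<notin> set xs" and sx: "set xs = {1..n}" using x by (auto simp: is_perm_def)
  have dy: "distinct ?ys" "0 \<notin> set ?ys" using y by (auto simp: is_perm_def)
  have xr: "1 \<le> xs ! i \<and> xs ! i \<le> n" if "i < n" for i using nth_mem[of i xs] that len sx by simp
  have sum: "n + 1 < u ! i + w ! (n - 1 - i)" if "i < n" for i
    unfolding u w by (rule irreducible_ups_sum) (use p q n that dyck_mu_aux[OF x] dyck_mu_aux[OF y] in auto)
  have ju: "i < n \<and> u ! i = xs ! i" if "i \<in> jumps u" for i
  proof -
    have "i < n" using that len by (simp add: jumps_def u' length_rmax)
    then show ?thesis using jumps_rmax_iff[OF dx, of i] that len by (simp add: u')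
  qed
  have jw: "j < n \<and> w ! j = n + 1 - xs ! (n - 1 - j)" if "j \<in> jumps w" for j
  proof -
    have "j < n" using that len by (simp add: jumps_def w' length_rmax)
    then show ?thesis using jumps_rmax_iff[OF dy, of j] that len nth_revcomp[of j xs] by (simp add: w')
  qed
  \<comment> \<open>An entry that is an extremum of both kinds would make its upper and lower bound
    coincide, against \<open>sum\<close>.\<close>
  have pos: "i + j \<noteq> n - 1" if "i \<in> jumps u" "j \<in> jumps w" for i j
  proof
    assume ij: "i + j = n - 1"
    have i: "i < n" "j = n - 1 - i" "n - 1 - j = i" using ju[OF that(1)] ij by auto
    have "u ! i + w ! j = n + 1" using ju[OF that(1)] jw[OF that(2)] i xr[of i] by simp
    then show False using sum[OF i(1)] i by simp
  qed
  have "a + b \<noteq> n + 1" if ab: "a \<in> set u" "b \<in> set w" for a b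
  proof
    assume s: "a + b = n + 1"
    obtain i where i: "i \<in> jumps u" "a = xs ! i" using rmax_value_at_jump[OF dx, of a] ab(1) by (auto simp: u')
    obtain j where j: "j \<in> jumps w" "b = ?ys ! j" using rmax_value_at_jump[OF dy, of b] ab(2) by (auto simp: w')
    have jn: "j < n" "i < n" using jw[OF j(1)] ju[OF i(1)] by auto
    then have "b = n + 1 - xs ! (n - 1 - j)" using j(2) nth_revcomp[of j xs] len by simp
    then have "xs ! i = xs ! (n - 1 - j)" using i s xr[of i] xr[of "n - 1 - j"] jn by simp
    then have "i = n - 1 - j" using nth_eq_iff_index_eq[OF dx(1), of i "n - 1 - j"] jn len by simp
    then show False using pos[OF i(1) j(1)] jn by simp
  qed
  then show "compatible n u w" using pos by (simp add: compatible_def)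
  show "enough_values n u w"
    unfolding enough_values_def
  proof
    fix d assume d: "d \<in> jumps u - {0}"
    then have dn: "d < n" "0 < d" using ju[of d] by auto
    let ?P = "{..<d} - (\<lambda>j. n - 1 - j) ` jumps w" and ?V = "{n + 1 - u ! (d - 1)..n} - set w"
    \<comment> \<open>The map sends a position to the entry of \<alpha> there. Before
      \<open>d\<close> every entry is at least the preceding minimum, and values in \<open>w\<close>
      occur only at positions of right-to-left maxima.\<close>
    have "inj_on (\<lambda>i. n + 1 - xs ! i) ?P"
    proof (rule inj_onI)
      fix i i' assume a: "i \<in> ?P" "i' \<in> ?P" "n + 1 - xs ! i = n + 1 - xs ! i'"
      then have "i < n" "i' < n" using dn by auto
      moreover from this have "xs ! i = xs ! i'" using a(3) xr[of i] xr[of i'] by linarith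
      ultimately show "i = i'" using nth_eq_iff_index_eq[OF dx(1)] len by simp
    qed
    moreover have "(\<lambda>i. n + 1 - xs ! i) ` ?P \<subseteq> ?V"
    proof
      fix v assume "v \<in> (\<lambda>i. n + 1 - xs ! i) ` ?P"
      then obtain i where i: "i < d" "i \<notin> (\<lambda>j. n - 1 - j) ` jumps w" "v = n + 1 - xs ! i" by auto
      have "xs ! i \<le> u ! (d - 1)" using nth_le_rmax[of i "d - 1" xs 0] i dn len by (simp add: u')
      moreover have "v \<notin> set w"
      proof
        assume "v \<in> set w"
        then obtain j where j: "j \<in> jumps w" "v = ?ys ! j" using rmax_value_at_jump[OF dy, of v] by (auto simp: w')
        have jn: "j < n" using jw[OF j(1)] by simp
        then have "n + 1 - xs ! i = n + 1 - xs ! (n - 1 - j)"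
          using j(2) i(3) nth_revcomp[of j xs] len by simp
        moreover have "xs ! i \<le> n" "xs ! (n - 1 - j) \<le> n" using xr[of i] xr[of "n - 1 - j"] jn i(1) dn by simp_all
        ultimately have "xs ! i = xs ! (n - 1 - j)" by linarith
        then have "i = n - 1 - j" using nth_eq_iff_index_eq[OF dx(1), of i "n - 1 - j"] jn i(1) dn len by simp
        then show False using i(2) j(1) by blast
      qed
      moreover have "v \<le> n" using i(1,3) dn xr[of i] by auto
      ultimately show "v \<in> ?V" using i(3) by (simp add: diff_le_mono2)
    qed
    ultimately show "card ?P \<le> card ?V" by (rule card_inj_on_le[OF _ _ finite_Diff[OF finite_atLeastAtMost]])
  qed
qed

section \<open>Positions and values left to fill\<close>

definition free_positions :: "nat \<Rightarrow> nat list \<Rightarrow> nat list \<Rightarrow> nat set" where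
  "free_positions n u w = {i. i < n \<and> i \<notin> jumps u \<and> n - 1 - i \<notin> jumps w}"

definition free_values :: "nat \<Rightarrow> nat list \<Rightarrow> nat list \<Rightarrow> nat set" where
  "free_values n u w = {v. 1 \<le> v \<and> v \<le> n \<and> v \<notin> set u \<and> n + 1 - v \<notin> set w}"

lemma jumps_values:
  assumes s: "sorted u"
  shows "inj_on (\<lambda>i. u ! i) (jumps u)" "(\<lambda>i. u ! i) ` jumps u = set u"
proof -
  have lt: "u ! i < u ! j" if "i \<in> jumps u" "j \<in> jumps u" "i < j" for i j
  proof -
    have "u ! i \<le> u ! (j - 1)" by (rule sorted_nth_mono[OF s]) (use that in \<open>auto simp: jumps_def\<close>)
    also have "\<dots> < u ! j" using that by (auto simp: jumps_def)
    finally show ?thesis .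
  qed
  show "inj_on (\<lambda>i. u ! i) (jumps u)"
    by (rule linorder_inj_onI) (use lt in force)+
  show "(\<lambda>i. u ! i) ` jumps u = set u"
  proof (intro equalityI subsetI)
    fix x assume "x \<in> set u"
    then obtain m where m: "m < length u" "u ! m = x" by (auto simp: in_set_conv_nth)
    define i where "i = (LEAST i. u ! i = x)"
    have i: "u ! i = x" unfolding i_def by (rule LeastI, rule m(2))
    have im: "i \<le> m" unfolding i_def by (rule Least_le, rule m(2))
    have "i = 0 \<or> u ! (i - 1) < u ! i"
    proof (cases "i = 0")
      case False
      then have "u ! (i - 1) \<noteq> x" using not_less_Least[of "i - 1" "\<lambda>i. u ! i = x"] i_def by simp
      moreover have "u ! (i - 1) \<le> u ! i" using sorted_nth_mono[OF s, of "i - 1" i] im m by simp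
      ultimately show ?thesis using i by simp
    qed simp
    then have "i \<in> jumps u" using im m by (simp add: jumps_def)
    then show "x \<in> (\<lambda>i. u ! i) ` jumps u" using i by blast
  qed (auto simp: jumps_def)
qed

text \<open>A sorted list has as many jumps as distinct values, and compatibility keeps the reserved
  sets disjoint, so equally many positions and values are removed.\<close>

lemma card_free:
  assumes su: "sorted u" "length u = n" "set u \<subseteq> {1..n}" and sw: "sorted w" "length w = n" "set w \<subseteq> {1..n}"
    and c: "compatible n u w"
  shows "card (free_positions n u w) = card (free_values n u w)"
proof -
  have J: "jumps u \<subseteq> {..<n}" "jumps w \<subseteq> {..<n}" using su sw by (auto simp: jumps_def)
  then have J': "jumps w \<subseteq> {..n - 1}" by fastforce
  have W': "set w \<subseteq> {..n + 1}" using sw(3) by fastforce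
  note mJ = mem_complement_image[OF J'] and mW = mem_complement_image[OF W']
  let ?I2 = "(\<lambda>j. n - 1 - j) ` jumps w" and ?V2 = "(\<lambda>y. n + 1 - y) ` set w"
  have "free_positions n u w = {..<n} - (jumps u \<union> ?I2)"
  proof (intro set_eqI)
    fix x
    show "x \<in> free_positions n u w \<longleftrightarrow> x \<in> {..<n} - (jumps u \<union> ?I2)"
      using mJ[of x] by (cases "x < n") (simp_all add: free_positions_def del: image_iff)
  qed
  moreover have dI: "jumps u \<inter> ?I2 = {}"
  proof -
    have False if "j \<in> jumps w" "n - 1 - j \<in> jumps u" for j
    proof -
      have "n - 1 - j + j \<noteq> n - 1" using c that unfolding compatible_def by blast
      then show False using J(2) that(1) by fastforce
    qed
    then show ?thesis by blast
  qed
  moreover have sI: "jumps u \<union> ?I2 \<subseteq> {..<n}" using J by fastforce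
  moreover have "finite (jumps u)" "finite ?I2" using J finite_subset by blast+
  ultimately have 1: "card (free_positions n u w) = n - (card (jumps u) + card (jumps w))"
    using card_complement_image[OF J'] by (simp add: card_Diff_subset card_Un_disjoint)
  have "free_values n u w = {1..n} - (set u \<union> ?V2)"
  proof (intro set_eqI)
    fix x
    show "x \<in> free_values n u w \<longleftrightarrow> x \<in> {1..n} - (set u \<union> ?V2)"
      using mW[of x] by (cases "x \<le> n") (auto simp add: free_values_def simp del: image_iff)
  qed
  moreover have "set u \<inter> ?V2 = {}"
  proof -
    have False if "y \<in> set w" "n + 1 - y \<in> set u" for y
    proof -
      have "n + 1 - y + y \<noteq> n + 1" using c that unfolding compatible_def by blast
      then show False using sw(3) that(1) by fastforce
    qed
    then show ?thesis by blast
  qed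
  moreover have "set u \<union> ?V2 \<subseteq> {1..n}" using su(3) sw(3) by fastforce
  ultimately have 2: "card (free_values n u w) = n - (card (set u) + card (set w))"
    using card_complement_image[OF W'] by (simp add: card_Diff_subset card_Un_disjoint)
  have "card (jumps v) = card (set v)" if "sorted v" for v
    using jumps_values[OF that] card_image by metis
  then show ?thesis using 1 2 su sw by simp
qed

text \<open>\<open>enough_values\<close> speaks only of jumps \<open>d\<close>, but \<open>u\<close>
  is constant from \<open>i\<close> up to the next jump, so passing to that jump can only enlarge
  the left side. If no jump follows, \<open>u ! i = n\<close> and every free value counts. The bound
  is strict because \<open>u ! i\<close> itself is never free.\<close>

lemma card_free_le:
  assumes su: "sorted u" "length u = n" "set u \<subseteq> {1..n}" and n: "u ! (n - 1) = n"
    and sw: "sorted w" "length w = n" "set w \<subseteq> {1..n}"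
    and c: "compatible n u w" and e: "enough_values n u w" and i: "i < n"
  shows "card {i' \<in> free_positions n u w. i' \<le> i} \<le> card {v \<in> free_values n u w. v < u ! i}"
proof (cases "\<exists>d\<in>jumps u. i < d")
  case False
  have const: "u ! m = u ! i" if "i \<le> m" "m < n" for m
    using that
  proof (induction m rule: dec_induct)
    case (step m)
    have "Suc m \<notin> jumps u" using False step by auto
    then have "u ! Suc m \<le> u ! m" using step su by (simp add: jumps_def)
    moreover have "u ! m \<le> u ! Suc m" using sorted_nth_mono[OF su(1), of m "Suc m"] step su by simp
    ultimately show ?case using step by simp
  qed simp
  have ui: "u ! i = n" using const[of "n - 1"] i n by simp
  have "n \<in> set u" using nth_mem[of i u] ui i su by simp
  then have "{v \<in> free_values n u w. v < u ! i} = free_values n u w"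
    unfolding ui by (auto simp: free_values_def le_less)
  moreover have "card {i' \<in> free_positions n u w. i' \<le> i} \<le> card (free_positions n u w)"
    by (rule card_mono) (auto simp: free_positions_def)
  ultimately show ?thesis using card_free[OF su sw c] by simp
next
  case True
  define d where "d = (LEAST d. d \<in> jumps u \<and> i < d)"
  have "d \<in> jumps u \<and> i < d" unfolding d_def using True LeastI_ex[of "\<lambda>d. d \<in> jumps u \<and> i < d"] by blast
  then have d: "d \<in> jumps u" "i < d" "d < n" using su by (auto simp: jumps_def)
  have const: "u ! m = u ! i" if "i \<le> m" "m < d" for m
    using that
  proof (induction m rule: dec_induct)
    case (step m)
    have "Suc m \<notin> jumps u"
      using not_less_Least[of "Suc m" "\<lambda>d. d \<in> jumps u \<and> i < d"] step d_def by auto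
    then have "u ! Suc m \<le> u ! m" using step su d by (simp add: jumps_def)
    moreover have "u ! m \<le> u ! Suc m" using sorted_nth_mono[OF su(1), of m "Suc m"] step su d by simp
    ultimately show ?case using step by simp
  qed simp
  define a where "a = u ! i"
  have ud: "u ! (d - 1) = a" using const[of "d - 1"] d by (simp add: a_def)
  have au: "a \<in> set u" using i su by (simp add: a_def)
  then have an: "1 \<le> a" "a \<le> n" using su(3) by auto
  have J: "jumps u \<subseteq> {..<n}" "jumps w \<subseteq> {..<n}" using su sw by (auto simp: jumps_def)
  then have J': "jumps w \<subseteq> {..n - 1}" by fastforce
  note mJ = mem_complement_image[OF J']
  let ?I2 = "(\<lambda>j. n - 1 - j) ` jumps w"
  let ?Fi = "{i' \<in> free_positions n u w. i' < d}" and ?Ji = "{i' \<in> jumps u. i' < d}"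
  let ?Fv = "{v \<in> free_values n u w. v < a}" and ?Jv = "{v \<in> set u. v \<le> a}"
  \<comment> \<open>Both counts in \<open>enough_values\<close> split into a free part and a part
    from the prescribed minima before \<open>d\<close>. The map \<open>i \<mapsto> u ! i\<close>
    matches the latter parts, so they cancel.\<close>
  have "{..<d} - ?I2 = ?Fi \<union> ?Ji"
  proof (intro set_eqI)
    fix x
    show "x \<in> {..<d} - ?I2 \<longleftrightarrow> x \<in> ?Fi \<union> ?Ji"
    proof (cases "x < d")
      case True
      then have m: "x \<in> ?I2 \<longleftrightarrow> n - 1 - x \<in> jumps w" using mJ[of x] d by simp
      have "n - 1 - x \<notin> jumps w" if "x \<in> jumps u"
      proof
        assume "n - 1 - x \<in> jumps w"
        then have "x + (n - 1 - x) \<noteq> n - 1" using c that unfolding compatible_def by blast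
        then show False using True d by simp
      qed
      then show ?thesis using m True d by (auto simp: free_positions_def)
    qed auto
  qed
  moreover have "?Fi \<inter> ?Ji = {}" by (auto simp: free_positions_def)
  moreover have "finite ?Fi" "finite ?Ji" by (rule finite_subset[of _ "{..<d}"]; auto)+
  ultimately have 1: "card ({..<d} - ?I2) = card ?Fi + card ?Ji" by (simp add: card_Un_disjoint)
  have Sn: "{n + 1 - a..n} - set w \<subseteq> {..n + 1}" by auto
  have "(\<lambda>v. n + 1 - v) ` ({n + 1 - a..n} - set w) = ?Fv \<union> ?Jv"
  proof (intro set_eqI)
    fix v
    show "v \<in> (\<lambda>v. n + 1 - v) ` ({n + 1 - a..n} - set w) \<longleftrightarrow> v \<in> ?Fv \<union> ?Jv"
    proof (cases "1 \<le> v \<and> v \<le> a")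
      case True
      then have m: "v \<in> (\<lambda>v. n + 1 - v) ` ({n + 1 - a..n} - set w) \<longleftrightarrow> n + 1 - v \<notin> set w"
        using mem_complement_image[OF Sn, of v] an by auto
      have "n + 1 - v \<notin> set w" if "v \<in> set u"
      proof
        assume "n + 1 - v \<in> set w"
        then have "v + (n + 1 - v) \<noteq> n + 1" using c that unfolding compatible_def by blast
        then show False using True an by simp
      qed
      then show ?thesis unfolding m using True an au
        by (cases "v = a") (auto simp: free_values_def)
    next
      case False
      then show ?thesis using su(3) an by (auto simp: free_values_def)
    qed
  qed
  then have "card ({n + 1 - a..n} - set w) = card (?Fv \<union> ?Jv)" using card_complement_image[OF Sn] by simp
  moreover have "?Fv \<inter> ?Jv = {}" by (auto simp: free_values_def)
  moreover have "finite ?Fv" by (rule finite_subset[of _ "{..<a}"]) auto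
  ultimately have 2: "card ({n + 1 - a..n} - set w) = card ?Fv + card ?Jv" by (simp add: card_Un_disjoint)
  have "(\<lambda>i. u ! i) ` ?Ji = ?Jv"
  proof (intro equalityI subsetI)
    fix x assume "x \<in> (\<lambda>i. u ! i) ` ?Ji"
    then obtain i' where i': "i' \<in> jumps u" "i' < d" "x = u ! i'" by blast
    then have "x \<le> u ! (d - 1)" using sorted_nth_mono[OF su(1), of i' "d - 1"] d su by simp
    moreover have "x \<in> set u" using i' d su by simp
    ultimately show "x \<in> ?Jv" using ud by simp
  next
    fix x assume x: "x \<in> ?Jv"
    then have "x \<in> (\<lambda>i. u ! i) ` jumps u" using jumps_values(2)[OF su(1)] by simp
    then obtain i' where i': "i' \<in> jumps u" "x = u ! i'" by blast
    have "u ! (d - 1) < u ! d" using d by (auto simp: jumps_def)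
    then have "u ! i' < u ! d" using x i' ud by simp
    moreover have "u ! d \<le> u ! i'" if "d \<le> i'"
      using sorted_nth_mono[OF su(1) that] i' by (simp add: jumps_def)
    ultimately have "i' < d" by (cases "i' < d") auto
    then show "x \<in> (\<lambda>i. u ! i) ` ?Ji" using i' by blast
  qed
  then have 3: "card ?Ji = card ?Jv"
    using card_image[of "\<lambda>i. u ! i" ?Ji] inj_on_subset[OF jumps_values(1)[OF su(1)], of ?Ji] by auto
  have "card ({..<d} - ?I2) \<le> card ({n + 1 - u ! (d - 1)..n} - set w)"
    using e d unfolding enough_values_def by auto
  then have "card ?Fi \<le> card ?Fv" using 1 2 3 ud by simp
  moreover have "card {i' \<in> free_positions n u w. i' \<le> i} \<le> card ?Fi"
    by (rule card_mono) (use d in \<open>auto simp: free_positions_def\<close>)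
  ultimately show ?thesis by (simp add: a_def)
qed

section \<open>The monotone filling\<close>

lemma ex_strict_mono_bij:
  fixes I V :: "nat set"
  assumes "finite I" "finite V" "card I = card V"
  shows "\<exists>h. bij_betw h I V \<and> strict_mono_on I h"
proof -
  obtain f where f: "bij_betw f {..<card I} I" "strict_mono_on {..<card I} f"
    using ex_bij_betw_strict_mono_card[OF assms(1)] by blast
  obtain g where g: "bij_betw g {..<card I} V" "strict_mono_on {..<card I} g"
    using ex_bij_betw_strict_mono_card[OF assms(2)] assms(3) by metis
  define k where "k = the_inv_into {..<card I} f"
  have k: "bij_betw k I {..<card I}" unfolding k_def by (rule bij_betw_the_inv_into[OF f(1)])
  have fk: "f (k x) = x" if "x \<in> I" for x
    using f_the_inv_into_f_bij_betw[OF f(1)] that by (simp add: k_def)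
  have "k x < k y" if "x \<in> I" "y \<in> I" "x < y" for x y
  proof (rule ccontr)
    assume "\<not> k x < k y"
    then have "f (k y) \<le> f (k x)"
      using strict_mono_on_leD[OF f(2), of "k y" "k x"] k that by (auto simp: bij_betw_def)
    then show False using fk that by simp
  qed
  then have "strict_mono_on I (g \<circ> k)"
    using bij_betw_apply[OF k] strict_mono_onD[OF g(2)] by (auto intro!: strict_mono_onI)
  moreover have "bij_betw (g \<circ> k) I V" by (rule bij_betw_trans[OF k g(1)])
  ultimately show ?thesis by blast
qed

text \<open>Between jumps \<open>u\<close> does not change, so entries that stay below it leave the
  running maximum alone.\<close>

lemma rmax_eqI:
  assumes "sorted u" "length xs = length u" "\<And>i. i < length u \<Longrightarrow> xs ! i \<le> u ! i"
    "\<And>i. i \<in> jumps u \<Longrightarrow> xs ! i = u ! i"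
  shows "rmax 0 xs = u"
proof (rule nth_equalityI)
  fix i assume "i < length (rmax 0 xs)"
  then have "i < length u" using assms by (simp add: length_rmax)
  then show "rmax 0 xs ! i = u ! i"
  proof (induction i)
    case 0
    then have "0 \<in> jumps u" by (simp add: jumps_def)
    moreover have "xs \<noteq> []" using 0 assms(2) by auto
    ultimately show ?case using rmax_0[of xs 0] assms(4)[of 0] by simp
  next
    case (Suc i)
    have r: "rmax 0 xs ! Suc i = max (u ! i) (xs ! Suc i)" using rmax_Suc[of i xs 0] Suc assms(2) by simp
    have le: "u ! i \<le> u ! Suc i" using sorted_nth_mono[OF assms(1), of i "Suc i"] Suc by simp
    show ?case
    proof (cases "Suc i \<in> jumps u")
      case True
      then show ?thesis using r le assms(4) by simp
    next
      case False
      then have "u ! Suc i \<le> u ! i" using Suc by (simp add: jumps_def)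
      then show ?thesis using r le assms(3)[OF Suc.prems] by simp
    qed
  qed
qed (simp add: assms length_rmax)

lemma realizable_of_conditions:
  assumes p: "irreducible_dyck p" "semilength p = n" and q: "irreducible_dyck q" "semilength q = n"
    and n: "2 \<le> n" and u: "u = ups 0 p" and w: "w = ups 0 q"
    and c: "compatible n u w" and eu: "enough_values n u w" and ew: "enough_values n w u"
  shows "realizable p q"
proof -
  note U = irreducible_ups[OF p u] and W = irreducible_ups[OF q w]
  have range: "set v \<subseteq> {1..n}" if r: "irreducible_dyck r" "semilength r = n" "v = ups 0 r" for r v
  proof
    note V = irreducible_ups[OF r]
    fix x assume "x \<in> set v"
    then obtain i where "i < n" "x = v ! i" using V(2) by (auto simp: in_set_conv_nth)
    moreover have "v ! 0 \<le> v ! i" using sorted_nth_mono[OF V(3), of 0 i] V(2) calculation by simp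
    ultimately show "x \<in> {1..n}" using V(5)[of i] V(6)[of 0] n by simp
  qed
  note su = U(3) U(2) range[OF p u] and sw = W(3) W(2) range[OF q w]
  have c': "compatible n w u" using c unfolding compatible_def by (metis add.commute)
  define I where "I = free_positions n u w"
  define V where "V = free_values n u w"
  have fI: "finite I" by (rule finite_subset[of _ "{..<n}"]) (auto simp: I_def free_positions_def)
  have fV: "finite V" by (rule finite_subset[of _ "{..n}"]) (auto simp: V_def free_values_def)
  have "card I = card V" using card_free[OF su sw c] by (simp add: I_def V_def)
  then obtain h where h: "bij_betw h I V" "strict_mono_on I h" using ex_strict_mono_bij[OF fI fV] by blast
  have sum: "n + 1 < u ! i + w ! (n - 1 - i)" if "i < n" for i
    unfolding u w by (rule irreducible_ups_sum[OF p q n that])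
  have wr: "1 \<le> w ! j \<and> w ! j \<le> n" if "j < n" for j using subsetD[OF sw(3) nth_mem[of j w]] that sw(2) by simp
  \<comment> \<open>Otherwise, \<open>h\<close> being increasing, all free values below
    \<open>u ! i\<close> would sit at free positions before \<open>i\<close>. By
    \<open>card_free_le\<close> there are at least as many such values as free positions up to and
    including \<open>i\<close>.\<close>
  have hless: "h i < u ! i" if i: "i \<in> I" for i
  proof (rule ccontr)
    assume a: "\<not> h i < u ! i"
    have "i < n" using i by (simp add: I_def free_positions_def)
    then have "card {i' \<in> I. i' \<le> i} \<le> card {v \<in> V. v < u ! i}"
      using card_free_le[OF su U(4) sw c eu] by (simp add: I_def V_def)
    also have "\<dots> \<le> card (h ` {i' \<in> I. i' < i})"
    proof (rule card_mono)
      show "{v \<in> V. v < u ! i} \<subseteq> h ` {i' \<in> I. i' < i}"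
      proof
        fix v assume v: "v \<in> {v \<in> V. v < u ! i}"
        then obtain i' where i': "i' \<in> I" "v = h i'" using h(1) by (auto simp: bij_betw_def)
        have "i' < i"
        proof (rule ccontr)
          assume "\<not> i' < i"
          then have "h i \<le> h i'" using strict_mono_on_leD[OF h(2) i i'(1)] by simp
          then show False using v i' a by simp
        qed
        then show "v \<in> h ` {i' \<in> I. i' < i}" using i' by blast
      qed
    qed (simp add: fI)
    also have "\<dots> \<le> card {i' \<in> I. i' < i}" by (rule card_image_le) (simp add: fI)
    also have "\<dots> < card {i' \<in> I. i' \<le> i}" by (rule psubset_card_mono) (use i fI in auto)
    finally show False by simp
  qed
  \<comment> \<open>The mirror image: reversing positions and complementing values exchanges
    \<open>u\<close> and \<open>w\<close>, so \<open>card_free_le\<close> applies with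
    \<open>ew\<close> and now counts the free positions from \<open>i\<close> on.\<close>
  have hgr: "n + 1 - w ! (n - 1 - i) < h i" if i: "i \<in> I" for i
  proof (rule ccontr)
    define b where "b = n + 1 - w ! (n - 1 - i)"
    assume "\<not> n + 1 - w ! (n - 1 - i) < h i"
    then have a: "h i \<le> b" by (simp add: b_def)
    have i_n: "i < n" using i by (simp add: I_def free_positions_def)
    define j where "j = n - 1 - i"
    have j: "j < n" using i_n by (simp add: j_def)
    have Fp: "{j' \<in> free_positions n w u. j' \<le> j} = (\<lambda>i. n - 1 - i) ` {i' \<in> I. i \<le> i'}"
    proof (intro equalityI subsetI)
      fix x assume x: "x \<in> {j' \<in> free_positions n w u. j' \<le> j}"
      then have "n - 1 - x \<in> {i' \<in> I. i \<le> i'}" using i_n by (auto simp: free_positions_def I_def j_def)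
      then have "n - 1 - (n - 1 - x) \<in> (\<lambda>i. n - 1 - i) ` {i' \<in> I. i \<le> i'}" by (rule imageI)
      moreover have "n - 1 - (n - 1 - x) = x" using x j by simp
      ultimately show "x \<in> (\<lambda>i. n - 1 - i) ` {i' \<in> I. i \<le> i'}" by (simp only:)
    qed (auto simp: free_positions_def I_def j_def)
    have "{i' \<in> I. i \<le> i'} \<subseteq> {..n - 1}" by (auto simp: I_def free_positions_def)
    then have "card {i' \<in> I. i \<le> i'} = card {j' \<in> free_positions n w u. j' \<le> j}"
      unfolding Fp by (simp only: card_complement_image)
    also have "\<dots> \<le> card {v \<in> free_values n w u. v < w ! j}"
      by (rule card_free_le[OF sw W(4) su c' ew j])
    also have "{v \<in> free_values n w u. v < w ! j} = (\<lambda>v. n + 1 - v) ` {v \<in> V. b < v}"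
    proof (intro equalityI subsetI)
      fix x assume x: "x \<in> {v \<in> free_values n w u. v < w ! j}"
      then have "n + 1 - x \<in> {v \<in> V. b < v}" using wr[OF j] by (auto simp: free_values_def V_def b_def j_def)
      then have "n + 1 - (n + 1 - x) \<in> (\<lambda>v. n + 1 - v) ` {v \<in> V. b < v}" by (rule imageI)
      moreover have "n + 1 - (n + 1 - x) = x" using x by (simp add: free_values_def)
      ultimately show "x \<in> (\<lambda>v. n + 1 - v) ` {v \<in> V. b < v}" by (simp only:)
    next
      fix x assume "x \<in> (\<lambda>v. n + 1 - v) ` {v \<in> V. b < v}"
      then obtain v where "v \<in> V" "b < v" "x = n + 1 - v" by blast
      then show "x \<in> {v \<in> free_values n w u. v < w ! j}"
        using wr[OF j] by (auto simp: free_values_def V_def b_def j_def)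
    qed
    also have "card ((\<lambda>v. n + 1 - v) ` {v \<in> V. b < v}) \<le> card {v \<in> V. b < v}"
      by (rule card_image_le) (simp add: fV)
    also have "\<dots> \<le> card (h ` {i' \<in> I. i < i'})"
    proof (rule card_mono)
      show "{v \<in> V. b < v} \<subseteq> h ` {i' \<in> I. i < i'}"
      proof
        fix v assume v: "v \<in> {v \<in> V. b < v}"
        then obtain i' where i': "i' \<in> I" "v = h i'" using h(1) by (auto simp: bij_betw_def)
        have "i < i'"
        proof (rule ccontr)
          assume "\<not> i < i'"
          then have "h i' \<le> h i" using strict_mono_on_leD[OF h(2) i'(1) i] by simp
          then show False using v i' a by simp
        qed
        then show "v \<in> h ` {i' \<in> I. i < i'}" using i' by blast
      qed
    qed (simp add: fI)
    also have "\<dots> \<le> card {i' \<in> I. i < i'}" by (rule card_image_le) (simp add: fI)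
    also have "\<dots> < card {i' \<in> I. i \<le> i'}" by (rule psubset_card_mono) (use i fI in auto)
    finally show False by simp
  qed
  \<comment> \<open>In the complement, the left-to-right minima of \<alpha> appear as entries of
    \<open>u\<close> and its right-to-left maxima as complements of entries of
    \<open>w\<close>.\<close>
  define \<sigma> where "\<sigma> i = (if i \<in> jumps u then u ! i
     else if n - 1 - i \<in> jumps w then n + 1 - w ! (n - 1 - i) else h i)" for i
  have nj: "i \<notin> jumps u" if "n - 1 - i \<in> jumps w" "i < n" for i
  proof
    assume "i \<in> jumps u"
    then have "i + (n - 1 - i) \<noteq> n - 1" using c that unfolding compatible_def by blast
    then show False using that by simp
  qed
  \<comment> \<open>A prescribed entry attains one of its bounds and satisfies the other by
    \<open>sum\<close>. These bounds are what prevents unwanted extrema on either side.\<close>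
  have bounds: "n + 1 - w ! (n - 1 - i) \<le> \<sigma> i \<and> \<sigma> i \<le> u ! i" if i: "i < n" for i
  proof -
    have "i \<in> I" if "i \<notin> jumps u" "n - 1 - i \<notin> jumps w"
      using that i by (simp add: I_def free_positions_def)
    then show ?thesis using sum[OF i] hless[of i] hgr[of i] by (auto simp: \<sigma>_def)
  qed
  have img: "\<sigma> ` {..<n} = {1..n}"
  proof (intro equalityI subsetI)
    fix x assume "x \<in> \<sigma> ` {..<n}"
    then obtain i where i: "i < n" "x = \<sigma> i" by auto
    have "1 \<le> n + 1 - w ! (n - 1 - i)" using wr[of "n - 1 - i"] i by auto
    then show "x \<in> {1..n}" using bounds[OF i(1)] U(5)[OF i(1)] i by simp
  next
    fix v assume v: "v \<in> {1..n}"
    consider "v \<in> set u" | "n + 1 - v \<in> set w" | "v \<in> V" using v by (auto simp: V_def free_values_def)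
    then show "v \<in> \<sigma> ` {..<n}"
    proof cases
      case 1
      then have "v \<in> (\<lambda>i. u ! i) ` jumps u" using jumps_values(2)[OF su(1)] by simp
      then obtain i where "i \<in> jumps u" "v = u ! i" by blast
      then show ?thesis using su(2) by (intro image_eqI[of _ _ i]) (auto simp: \<sigma>_def jumps_def)
    next
      case 2
      then have "n + 1 - v \<in> (\<lambda>i. w ! i) ` jumps w" using jumps_values(2)[OF sw(1)] by simp
      then obtain j where j: "j \<in> jumps w" "n + 1 - v = w ! j" by blast
      then have jn: "j < n" using sw(2) by (simp add: jumps_def)
      then have "n - 1 - (n - 1 - j) = j" by simp
      then have "\<sigma> (n - 1 - j) = n + 1 - w ! j" using nj[of "n - 1 - j"] j(1) jn by (simp add: \<sigma>_def)
      also have "\<dots> = v" using j(2) v by auto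
      finally show ?thesis using jn by (intro image_eqI[of _ _ "n - 1 - j"]) auto
    next
      case 3
      then obtain i where i: "i \<in> I" "v = h i" using h(1) by (auto simp: bij_betw_def)
      then show ?thesis by (intro image_eqI[of _ _ i]) (auto simp: \<sigma>_def I_def free_positions_def)
    qed
  qed
  define xs where "xs = map \<sigma> [0..<n]"
  have len: "length xs = n" by (simp add: xs_def)
  have "inj_on \<sigma> {..<n}" by (rule eq_card_imp_inj_on) (simp_all add: img)
  then have perm: "is_perm n xs"
    using img by (simp add: is_perm_def xs_def distinct_map atLeast0LessThan)
  have "rmax 0 xs = u"
  proof (rule rmax_eqI)
    fix i assume "i < length u"
    then show "xs ! i \<le> u ! i" using bounds[of i] su(2) by (simp add: xs_def)
  next
    fix i assume "i \<in> jumps u"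
    then show "xs ! i = u ! i" using su(2) by (simp add: xs_def \<sigma>_def jumps_def)
  qed (use su len in auto)
  then have mp: "mu_aux 0 xs = p" using mu_aux_eq_iff irreducible_dyckD[OF p(1)] u by simp
  have rc: "revcomp xs ! j = n + 1 - \<sigma> (n - 1 - j)" if "j < n" for j
    using nth_revcomp[of j xs] that len by (simp add: xs_def)
  have "rmax 0 (revcomp xs) = w"
  proof (rule rmax_eqI)
    fix j assume "j < length w"
    then have j: "j < n" using sw(2) by simp
    then have "n - 1 - (n - 1 - j) = j" by simp
    then have "n + 1 - w ! j \<le> \<sigma> (n - 1 - j)" using bounds[of "n - 1 - j"] j by simp
    then show "revcomp xs ! j \<le> w ! j" using rc[OF j] by linarith
  next
    fix j assume jw: "j \<in> jumps w"
    then have j: "j < n" using sw(2) by (simp add: jumps_def)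
    then have e: "n - 1 - (n - 1 - j) = j" by simp
    then have "\<sigma> (n - 1 - j) = n + 1 - w ! j" using nj[of "n - 1 - j"] jw j by (simp add: \<sigma>_def)
    then show "revcomp xs ! j = w ! j" using rc[OF j] wr[OF j] by simp
  qed (use sw len in \<open>auto simp: revcomp_def\<close>)
  then have mq: "mu_aux 0 (revcomp xs) = q" using mu_aux_eq_iff irreducible_dyckD[OF q(1)] w by simp
  show ?thesis unfolding realizable_def using perm mp mq len by (intro exI[of _ xs]) simp
qed

lemma realizable_iff_irr_le:
  assumes p: "irreducible_dyck p" and q: "irreducible_dyck q"
  shows "realizable p q \<longleftrightarrow> irr_le (L'_irr q) p \<and> irr_le (L'_irr p) q"
proof (cases "semilength p = semilength q")
  case False
  have "\<not> irr_le (L'_irr q) p" using L'_irr_code(2)[OF q refl] False by (simp add: irr_le_def)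
  then show ?thesis using realizable_dyck(3) False by blast
next
  case True
  define n where "n = semilength p"
  have np: "semilength p = n" and nq: "semilength q = n" using True by (simp_all add: n_def)
  show ?thesis
  proof (cases "2 \<le> n")
    \<comment> \<open>For \<open>n = 1\<close> the only letter is both a left-to-right minimum and a
      right-to-left maximum, so \<open>compatible\<close> fails although the pair is realizable.
      Hence the separate case.\<close>
    case False
    have one: "r = [True, False]" if r: "irreducible_dyck r" "semilength r = n" for r
    proof -
      obtain R where R: "r = True # R @ [False]" "dyck R" using r irreducible_dyck_iff_lift by auto
      then have "semilength R = 0" using r(2) False by (simp add: semilength_def)
      then show ?thesis using R semilength_eq_0_iff[OF R(2)] by simp
    qed
    have "p = [True, False]" "q = [True, False]" using one p q np nq by auto
    moreover have "L'_irr p = [True, False]" "L'_irr q = [True, False]"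
      using one[OF L'_irr_code(1,2)[OF p np]] one[OF L'_irr_code(1,2)[OF q nq]] by simp_all
    moreover have "realizable [True, False] [True, False]"
      unfolding realizable_def by (intro exI[of _ "[1]"]) (auto simp: is_perm_def revcomp_def)
    moreover have "irr_le [True, False] [True, False]" using p \<open>p = _\<close> by (simp add: irr_le_def)
    ultimately show ?thesis by simp
  next
    case n: True
    note 1 = irr_le_L'_iff[OF p np q nq n refl refl] and 2 = irr_le_L'_iff[OF q nq p np n refl refl]
    show ?thesis
    proof
      assume "realizable p q"
      then obtain xs where xs: "is_perm (length xs) xs" "mu_aux 0 xs = p" "mu_aux 0 (revcomp xs) = q"
        unfolding realizable_def by blast
      have len: "length xs = n" using dyck_mu_aux(2)[OF xs(1)] xs(2) np by simp
      have x: "is_perm n xs" and y: "is_perm n (revcomp xs)" using xs(1) len is_perm_revcomp by auto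
      have rr: "revcomp (revcomp xs) = xs" by (rule revcomp_revcomp[OF x])
      show "irr_le (L'_irr q) p \<and> irr_le (L'_irr p) q"
        unfolding 1 2 using realized_conditions[OF x _ _ n refl refl]
          realized_conditions[OF y _ _ n refl refl] p q xs(2,3) rr by simp
    next
      assume "irr_le (L'_irr q) p \<and> irr_le (L'_irr p) q"
      then show "realizable p q"
        using realizable_of_conditions[OF p np q nq n refl refl] unfolding 1 2 by blast
    qed
  qed
qed

theorem theorem7:
  fixes P Q :: "bool list" and n :: nat
  assumes "dyck P" and "dyck Q"
    and "semilength P = n" and "semilength Q = n"
  shows "(\<exists>\<alpha>. is_perm n \<alpha> \<and> lam \<alpha> = P \<and> mu \<alpha> = Q) \<longleftrightarrow>
         dyck_le (L' Q) P \<and> dyck_le (L' P) Q"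
proof -
  obtain Ps where Ps: "concat Ps = P" "\<forall>p\<in>set Ps. irreducible_dyck p"
    using dyck_concat_irreducible[OF assms(1)] by blast
  obtain Qs where Qs: "concat Qs = Q" "\<forall>q\<in>set Qs. irreducible_dyck q"
    using dyck_concat_irreducible[OF assms(2)] by blast
  have L': "L' (concat Rs) = concat (rev (map L'_irr Rs))"
      "components (L' (concat Rs)) = rev (map L'_irr Rs)"
    if "\<forall>r\<in>set Rs. irreducible_dyck r" for Rs
  proof -
    show e: "L' (concat Rs) = concat (rev (map L'_irr Rs))"
      unfolding L'_def components_concat[OF that] ..
    show "components (L' (concat Rs)) = rev (map L'_irr Rs)"
      unfolding e by (rule components_concat) (use that L'_irr_code(1) in auto)
  qed
  \<comment> \<open>\<open>L'\<close> reverses components, and realizability also pairs the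
    components of \<open>P\<close> with those of \<open>Q\<close> in reverse order, so all three
    conditions are brought to the pairing of \<open>Ps\<close> with \<open>rev Qs\<close>.\<close>
  have "dyck_le (L' Q) P \<longleftrightarrow> list_all2 irr_le (rev (map L'_irr Qs)) Ps"
    using L'(2)[OF Qs(2)] components_concat[OF Ps(2)] Ps(1) Qs(1) by (simp add: dyck_le_def)
  also have "\<dots> \<longleftrightarrow> list_all2 (\<lambda>p q. irr_le (L'_irr q) p) Ps (rev Qs)"
    by (auto simp: rev_map list_all2_conv_all_nth)
  finally have 1: "dyck_le (L' Q) P \<longleftrightarrow> list_all2 (\<lambda>p q. irr_le (L'_irr q) p) Ps (rev Qs)" .
  have "dyck_le (L' P) Q \<longleftrightarrow> list_all2 irr_le (rev (map L'_irr Ps)) Qs"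
    using L'(2)[OF Ps(2)] components_concat[OF Qs(2)] Ps(1) Qs(1) by (simp add: dyck_le_def)
  also have "\<dots> \<longleftrightarrow> list_all2 irr_le (map L'_irr Ps) (rev Qs)"
    using list_all2_rev[of irr_le "map L'_irr Ps" "rev Qs"] by simp
  also have "\<dots> \<longleftrightarrow> list_all2 (\<lambda>p q. irr_le (L'_irr p) q) Ps (rev Qs)"
    by (simp add: list_all2_map1)
  finally have 2: "dyck_le (L' P) Q \<longleftrightarrow> list_all2 (\<lambda>p q. irr_le (L'_irr p) q) Ps (rev Qs)" .
  have "(\<exists>\<alpha>. is_perm n \<alpha> \<and> lam \<alpha> = P \<and> mu \<alpha> = Q) \<longleftrightarrow> realizable P Q"
    by (rule ex_perm_iff_realizable[OF assms(1,3)])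
  also have "\<dots> \<longleftrightarrow> list_all2 realizable Ps (rev Qs)"
    using realizable_concat_iff[of Ps "rev Qs"] Ps Qs by simp
  also have "\<dots> \<longleftrightarrow> list_all2 (\<lambda>p q. irr_le (L'_irr q) p \<and> irr_le (L'_irr p) q) Ps (rev Qs)"
  proof -
    have "realizable (Ps ! i) (rev Qs ! i) \<longleftrightarrow>
        irr_le (L'_irr (rev Qs ! i)) (Ps ! i) \<and> irr_le (L'_irr (Ps ! i)) (rev Qs ! i)"
      if "i < length Ps" "length Ps = length (rev Qs)" for i
    proof (rule realizable_iff_irr_le)
      show "irreducible_dyck (Ps ! i)" using Ps(2) that(1) by simp
      have "rev Qs ! i \<in> set (rev Qs)" using that by (intro nth_mem) simp
      then show "irreducible_dyck (rev Qs ! i)" using Qs(2) by simp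
    qed
    then show ?thesis unfolding list_all2_conv_all_nth by blast
  qed
  also have "\<dots> \<longleftrightarrow> dyck_le (L' Q) P \<and> dyck_le (L' P) Q"
    unfolding 1 2 list_all2_conv_all_nth by blast
  finally show ?thesis .
qed

end
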